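(* Let $K$ be a totally imaginary cyclic quartic number field. Then \[ \tfrac{1}{128}\, D_K^{1/3} \le M(\mathcal{O}_K). \]
   Context: For a nonconstant polynomial $f(x)=c\prod_{i=1}^d (x-\alpha_i)\in\mathbb{C}[x]$, the Mahler measure is $M(f)=|c|\prod_{|\alpha_i|\ge 1}|\alpha_i|$. For an algebraic number $\alpha$, $M(\alpha)$ is the Mahler measure of its minimal polynomial over $\mathbb{Z}$ (with content $1$). For a number field $K$ with ring of integers $\mathcal{O}_K$ and absolute discriminant $D_K$, $M(\mathcal{O}_K)=\min\{M(\alpha):\alpha\in\mathcal{O}_K,\ \mathbb{Q}(\alpha)=K\}$. A cyclic quartic field is a Galois quartic field with Galois group $\mathbb{Z}/4\mathbb{Z}$. *)

theory Defs
  imports Complex_Main "HOL-Computational_Algebra.Polynomial" "Jordan_Normal_Form.Determinant"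
begin

text \<open>Number fields are modelled as subfields of the complex numbers (every number field
embeds into C, and all notions below are invariant under isomorphism).\<close>

definition subfield_C :: "complex set \<Rightarrow> bool" where
  "subfield_C K \<longleftrightarrow> 0 \<in> K \<and> 1 \<in> K \<and> (\<forall>x\<in>K. \<forall>y\<in>K. x + y \<in> K \<and> x * y \<in> K)
     \<and> (\<forall>x\<in>K. - x \<in> K) \<and> (\<forall>x\<in>K. x \<noteq> 0 \<longrightarrow> inverse x \<in> K)"

definition Q_basis :: "complex set \<Rightarrow> (nat \<Rightarrow> complex) \<Rightarrow> nat \<Rightarrow> bool" where
  "Q_basis K b n \<longleftrightarrow> (\<forall>i<n. b i \<in> K) \<and>
     (\<forall>x\<in>K. \<exists>!c::nat \<Rightarrow> rat. (\<forall>i\<ge>n. c i = 0) \<and> x = (\<Sum>i<n. of_rat (c i) * b i))"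

definition number_field :: "complex set \<Rightarrow> bool" where
  "number_field K \<longleftrightarrow> subfield_C K \<and> (\<exists>b n. Q_basis K b n)"

definition field_degree :: "complex set \<Rightarrow> nat" where
  "field_degree K = (LEAST n. \<exists>b. Q_basis K b n)"

definition embeddings :: "complex set \<Rightarrow> (complex \<Rightarrow> complex) set" where
  "embeddings K = {\<sigma>. \<sigma> 1 = 1 \<and> (\<forall>x\<in>K. \<forall>y\<in>K. \<sigma> (x + y) = \<sigma> x + \<sigma> y \<and> \<sigma> (x * y) = \<sigma> x * \<sigma> y)
                      \<and> (\<forall>x. x \<notin> K \<longrightarrow> \<sigma> x = 0)}"

definition totally_imaginary :: "complex set \<Rightarrow> bool" where
  "totally_imaginary K \<longleftrightarrow> (\<forall>\<sigma>\<in>embeddings K. \<exists>x\<in>K. \<sigma> x \<notin> \<real>)"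

text \<open>Galois (normal) over Q: every embedding maps K onto K, so the embeddings are exactly
the automorphisms. Cyclic quartic: degree 4, Galois, and the Galois group (of order 4)
contains an element of order 4.\<close>
definition galois_over_Q :: "complex set \<Rightarrow> bool" where
  "galois_over_Q K \<longleftrightarrow> (\<forall>\<sigma>\<in>embeddings K. \<sigma> ` K = K)"

definition cyclic_quartic :: "complex set \<Rightarrow> bool" where
  "cyclic_quartic K \<longleftrightarrow> number_field K \<and> field_degree K = 4 \<and> galois_over_Q K \<and>
     (\<exists>\<sigma>\<in>embeddings K. (\<forall>x\<in>K. (\<sigma> ^^ 4) x = x) \<and> \<not> (\<forall>x\<in>K. (\<sigma> ^^ 2) x = x))"

definition algebraic_integer :: "complex \<Rightarrow> bool" where
  "algebraic_integer x \<longleftrightarrow> (\<exists>p::int poly. lead_coeff p = 1 \<and> poly (map_poly of_int p) x = 0)"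

definition ring_of_integers :: "complex set \<Rightarrow> complex set" where
  "ring_of_integers K = {x \<in> K. algebraic_integer x}"

definition integral_basis :: "complex set \<Rightarrow> (nat \<Rightarrow> complex) \<Rightarrow> bool" where
  "integral_basis K \<omega> \<longleftrightarrow> (\<forall>i<field_degree K. \<omega> i \<in> ring_of_integers K) \<and>
     (\<forall>x\<in>ring_of_integers K. \<exists>!c::nat \<Rightarrow> int. (\<forall>i\<ge>field_degree K. c i = 0) \<and>
        x = (\<Sum>i<field_degree K. of_int (c i) * \<omega> i))"

definition field_trace :: "complex set \<Rightarrow> complex \<Rightarrow> complex" where
  "field_trace K x = (\<Sum>\<sigma>\<in>embeddings K. \<sigma> x)"

definition abs_discriminant :: "complex set \<Rightarrow> real" where
  "abs_discriminant K = (let \<omega> = (SOME \<omega>. integral_basis K \<omega>); n = field_degree K in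
     cmod (det (mat n n (\<lambda>(i, j). field_trace K (\<omega> i * \<omega> j)))))"

definition mahler_measure :: "complex poly \<Rightarrow> real" where
  "mahler_measure f = cmod (lead_coeff f) *
     (\<Prod>x\<in>{x. poly f x = 0}. (max 1 (cmod x)) ^ order x f)"

definition min_poly_Z :: "complex \<Rightarrow> int poly" where
  "min_poly_Z \<alpha> = (THE p. p \<noteq> 0 \<and> poly (map_poly of_int p) \<alpha> = 0 \<and> content p = 1 \<and> lead_coeff p > 0 \<and>
      (\<forall>q. q \<noteq> 0 \<and> poly (map_poly of_int q) \<alpha> = 0 \<longrightarrow> degree p \<le> degree q))"

definition mahler_measure_alg :: "complex \<Rightarrow> real" where
  "mahler_measure_alg \<alpha> = mahler_measure (map_poly of_int (min_poly_Z \<alpha>))"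

definition gen_field :: "complex \<Rightarrow> complex set" where
  "gen_field \<alpha> = \<Inter>{F. subfield_C F \<and> \<alpha> \<in> F}"

definition mahler_measure_OK :: "complex set \<Rightarrow> real" where
  "mahler_measure_OK K = Inf {mahler_measure_alg \<alpha> | \<alpha>. \<alpha> \<in> ring_of_integers K \<and> gen_field \<alpha> = K}"

end

theory Submission
  imports Defs "Jordan_Normal_Form.Char_Poly"
begin

text \<open>Let \<open>\<sigma>\<close> generate the Galois group; since \<open>K\<close> is totally imaginary, \<open>\<sigma>\<^sup>2\<close> is complex
  conjugation. For an integral generator \<open>\<alpha>\<close> put \<open>g = \<alpha> - \<sigma>\<^sup>2 \<alpha>\<close> and \<open>d = g \<sigma>(g)\<close>, so that
  \<open>\<sigma>\<^sup>2 g = - g\<close> and \<open>\<sigma> d = - d\<close>. The integers \<open>1, d, g, g d\<close> have discriminant \<open>256 d\<^sup>6\<close>, which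
  therefore bounds the discriminant of \<open>K\<close>. As \<open>|g| \<le> 2 |\<alpha>|\<close>, \<open>|\<sigma> g| \<le> 2 |\<sigma> \<alpha>|\<close> and
  \<open>|\<alpha> \<sigma>(\<alpha>)|\<^sup>2 \<le> M(\<alpha>)\<close>, this gives \<open>2^20 M(\<alpha>)\<^sup>3\<close> as an upper bound, which is below \<open>(128 M(\<alpha>))\<^sup>3\<close>.\<close>

section \<open>Algebraic integers\<close>

text \<open>The choice of \<open>d\<close> follows from what the Mahler measure controls. It bounds
  the product of |\<alpha>| and |\<sigma> \<alpha>| by M(\<alpha>)^(1/2), but one of the two factors
  alone may already be that large. The discriminant of the powers of \<open>g\<close> contains (g^2
  - (\<sigma> g)^2)^4, which is not a function of g * \<sigma> g and would cost further powers of
  M(\<alpha>). With \<open>d\<close> in place of g^2 only a power of g * \<sigma> g remains. Its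
  exponent 6 against the exponent 1/2 above gives M(\<alpha>)^3, hence the cube root in the theorem.
  In 2^20 = 256 * 4^6, the 256 belongs to the discriminant and the 4 is the product of the two
  factors 2 in the bounds for |g| and |\<sigma> g|.

  A second obstacle lies in the definitions: the discriminant uses a basis picked by
  \<open>SOME\<close>, and the trace is a sum over all embeddings. So an integral basis has to be
  shown to exist, and the embeddings have to be determined. Both are done by linear algebra with
  Gram determinants of explicit families.\<close>

definition int_span :: "complex set \<Rightarrow> complex set" where
  "int_span S = {x. \<exists>c :: complex \<Rightarrow> int. x = (\<Sum>s\<in>S. of_int (c s) * s)}"

lemma int_span_base:
  assumes "finite S" "s \<in> S" shows "s \<in> int_span S"
proof -
  have "(\<Sum>t\<in>S. of_int (if t = s then 1 else 0) * t) = (\<Sum>t\<in>S. if t = s then t else 0)"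
    by (intro sum.cong) auto
  then show ?thesis using assms unfolding int_span_def
    by (intro CollectI exI[of _ "\<lambda>t. if t = s then 1 else 0"]) simp
qed

lemma int_span_0: "0 \<in> int_span S"
  unfolding int_span_def by (auto intro!: exI[of _ "\<lambda>_. 0"])

lemma int_span_add:
  assumes "x \<in> int_span S" "y \<in> int_span S" shows "x + y \<in> int_span S"
proof -
  obtain c d :: "complex \<Rightarrow> int"
    where "x = (\<Sum>s\<in>S. of_int (c s) * s)" "y = (\<Sum>s\<in>S. of_int (d s) * s)"
    using assms unfolding int_span_def by auto
  then have "x + y = (\<Sum>s\<in>S. of_int (c s + d s) * s)"
    by (simp add: sum.distrib algebra_simps)
  then show ?thesis
    unfolding int_span_def by (intro CollectI exI[of _ "\<lambda>s. c s + d s"])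
qed

lemma int_span_of_int_mult:
  assumes "x \<in> int_span S" shows "of_int k * x \<in> int_span S"
proof -
  obtain c :: "complex \<Rightarrow> int" where "x = (\<Sum>s\<in>S. of_int (c s) * s)"
    using assms unfolding int_span_def by auto
  then have "of_int k * x = (\<Sum>s\<in>S. of_int (k * c s) * s)"
    by (simp add: sum_distrib_left algebra_simps)
  then show ?thesis
    unfolding int_span_def by (intro CollectI exI[of _ "\<lambda>s. k * c s"])
qed

lemma int_span_sum:
  assumes "\<And>i. i \<in> I \<Longrightarrow> f i \<in> int_span S" shows "sum f I \<in> int_span S"
  using assms by (induction I rule: infinite_finite_induct) (auto intro: int_span_0 int_span_add)

lemma int_span_mult_stable:
  assumes "\<And>s. s \<in> S \<Longrightarrow> z * s \<in> int_span S" and "x \<in> int_span S"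
  shows "z * x \<in> int_span S"
proof -
  obtain c :: "complex \<Rightarrow> int" where "x = (\<Sum>s\<in>S. of_int (c s) * s)"
    using assms unfolding int_span_def by auto
  then have "z * x = (\<Sum>s\<in>S. of_int (c s) * (z * s))"
    by (simp add: sum_distrib_left algebra_simps)
  then show ?thesis by (auto intro!: int_span_sum int_span_of_int_mult assms)
qed

text \<open>The determinant trick: multiplication by \<open>z\<close> acts on the generators through
  an integer matrix, and the vector of generators is an eigenvector for \<open>z\<close>. Hence
  \<open>z\<close> is a root of the characteristic polynomial, which is monic and integral. The
  element \<open>s0\<close> keeps that vector from being zero.\<close>

lemma algebraic_integer_if_stable:
  assumes fin: "finite S" and s0: "s0 \<in> S" "s0 \<noteq> 0"
    and st: "\<And>s. s \<in> S \<Longrightarrow> z * s \<in> int_span S"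
  shows "algebraic_integer z"
proof -
  obtain h where h: "bij_betw h {0..<card S} S"
    using ex_bij_betw_nat_finite[OF fin] by blast
  define n where "n = card S"
  have "\<exists>c :: complex \<Rightarrow> complex \<Rightarrow> int. \<forall>s\<in>S. z * s = (\<Sum>t\<in>S. of_int (c s t) * t)"
    using st unfolding int_span_def by (intro bchoice) auto
  then obtain c :: "complex \<Rightarrow> complex \<Rightarrow> int"
    where c: "\<And>s. s \<in> S \<Longrightarrow> z * s = (\<Sum>t\<in>S. of_int (c s t) * t)" by blast
  define A where "A = mat n n (\<lambda>(i, j). c (h i) (h j))"
  define B :: "complex mat" where "B = map_mat of_int A"
  have A: "A \<in> carrier_mat n n" and B: "B \<in> carrier_mat n n"
    unfolding A_def B_def by auto
  have hS: "h i \<in> S" if "i < n" for i using h that unfolding n_def bij_betw_def by auto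
  have Bv: "B *\<^sub>v vec n h = z \<cdot>\<^sub>v vec n h"
  proof (rule eq_vecI)
    fix i assume "i < dim_vec (z \<cdot>\<^sub>v vec n h)"
    then have i: "i < n" by simp
    have "z * h i = (\<Sum>t\<in>S. of_int (c (h i) t) * t)" using c hS i by blast
    also have "\<dots> = (\<Sum>j = 0..<n. of_int (c (h i) (h j)) * h j)"
      unfolding n_def by (rule sum.reindex_bij_betw[OF h, symmetric])
    finally show "(B *\<^sub>v vec n h) $ i = (z \<cdot>\<^sub>v vec n h) $ i"
      using i by (simp add: B_def A_def scalar_prod_def)
  qed (use B in auto)
  have "s0 \<in> h ` {0..<n}" using h s0 unfolding n_def bij_betw_def by simp
  then obtain k where k: "k < n" "h k = s0" by auto
  have "vec n h \<noteq> 0\<^sub>v n"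
  proof
    assume "vec n h = 0\<^sub>v n"
    then have "vec n h $ k = 0\<^sub>v n $ k" by simp
    then show False using k s0 by simp
  qed
  with Bv B have "eigenvalue B z"
    unfolding eigenvalue_def eigenvector_def by (intro exI[of _ "vec n h"]) auto
  then have "poly (char_poly B) z = 0"
    using eigenvalue_root_char_poly[OF B] by simp
  then have "poly (map_poly of_int (char_poly A)) z = 0"
    unfolding B_def of_int_hom.char_poly_hom[OF A] .
  then show ?thesis
    unfolding algebraic_integer_def using degree_monic_char_poly[OF A] by blast
qed

text \<open>The monic relation rewrites the top power by lower ones. The factor \<open>w\<close>
  stands for a power of a second integer, so that mixed monomials can be reduced in one variable at
  a time.\<close>

lemma monic_power_in_int_span:
  fixes p :: "int poly"
  assumes "lead_coeff p = 1" and "poly (map_poly of_int p) x = (0 :: complex)"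
    and "\<And>i. i < degree p \<Longrightarrow> x ^ i * w \<in> int_span S"
  shows "x ^ degree p * w \<in> int_span S"
proof -
  have "0 = (\<Sum>i\<le>degree p. of_int (coeff p i) * x ^ i)"
    using assms(2) by (simp add: poly_altdef)
  also have "{..degree p} = insert (degree p) {..<degree p}" by auto
  finally have "x ^ degree p = (\<Sum>i<degree p. of_int (- coeff p i) * x ^ i)"
    using assms(1) by (simp add: sum_negf eq_neg_iff_add_eq_0)
  then have "x ^ degree p * w = (\<Sum>i<degree p. of_int (- coeff p i) * (x ^ i * w))"
    by (simp add: sum_distrib_right mult.assoc)
  then show ?thesis using assms(3) by (auto intro!: int_span_sum int_span_of_int_mult simp del: of_int_minus)
qed

text \<open>The monomials x^i y^j with exponents below the two degrees span a module stable under
  both numbers. One such module serves for the sum and for the product.\<close>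

lemma algebraic_integer_common_module:
  assumes "algebraic_integer x" "algebraic_integer y"
  obtains S where "finite S" "1 \<in> S"
    "\<And>s. s \<in> S \<Longrightarrow> x * s \<in> int_span S" "\<And>s. s \<in> S \<Longrightarrow> y * s \<in> int_span S"
proof -
  obtain p q :: "int poly" where p: "lead_coeff p = 1" "poly (map_poly of_int p) x = 0"
    and q: "lead_coeff q = 1" "poly (map_poly of_int q) y = 0"
    using assms unfolding algebraic_integer_def by blast
  \<comment> \<open>A monic constant is 1 and has no root; so both degrees are positive and 1 = x^0
    y^0 lies in \<open>S\<close>.\<close>
  have deg: "degree r > 0"
    if r: "lead_coeff r = 1" "poly (map_poly of_int r) z = 0" for r :: "int poly" and z :: complex
  proof (rule ccontr)
    assume "\<not> 0 < degree r"
    then obtain a where "r = [:a:]" by (auto elim: degree_eq_zeroE)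
    with r show False by (simp add: map_poly_pCons)
  qed
  define S where "S = (\<lambda>(i, j). x ^ i * y ^ j) ` ({..<degree p} \<times> {..<degree q})"
  have fin: "finite S" unfolding S_def by simp
  have S: "x ^ i * y ^ j \<in> S" if "i < degree p" "j < degree q" for i j
    using that unfolding S_def by force
  have "1 \<in> S" using S[of 0 0] deg p q by auto
  moreover have "x * s \<in> int_span S" if "s \<in> S" for s
  proof -
    obtain i j where ij: "i < degree p" "j < degree q" "s = x ^ i * y ^ j"
      using \<open>s \<in> S\<close> unfolding S_def by auto
    have xs: "x * s = x ^ Suc i * y ^ j" using ij by simp
    have "x ^ i * y ^ j \<in> int_span S" if "i < degree p" for i
      using int_span_base[OF fin S[OF that ij(2)]] .
    then show ?thesis
      unfolding xs using monic_power_in_int_span[OF p, of "y ^ j" S] ij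
      by (cases "Suc i = degree p") (simp_all add: Suc_lessI del: power_Suc)
  qed
  moreover have "y * s \<in> int_span S" if "s \<in> S" for s
  proof -
    obtain i j where ij: "i < degree p" "j < degree q" "s = x ^ i * y ^ j"
      using \<open>s \<in> S\<close> unfolding S_def by auto
    have ys: "y * s = y ^ Suc j * x ^ i" using ij by simp
    have "y ^ j * x ^ i \<in> int_span S" if "j < degree q" for j
      using int_span_base[OF fin S[OF ij(1) that]] by (simp add: mult.commute)
    then show ?thesis
      unfolding ys using monic_power_in_int_span[OF q, of "x ^ i" S] ij
      by (cases "Suc j = degree q") (simp_all add: Suc_lessI del: power_Suc)
  qed
  ultimately show ?thesis using that fin by blast
qed

lemma algebraic_integer_add:
  assumes "algebraic_integer x" "algebraic_integer y" shows "algebraic_integer (x + y)"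
proof -
  obtain S where S: "finite S" "1 \<in> S"
    "\<And>s. s \<in> S \<Longrightarrow> x * s \<in> int_span S" "\<And>s. s \<in> S \<Longrightarrow> y * s \<in> int_span S"
    using algebraic_integer_common_module[OF assms] by blast
  show ?thesis
    by (rule algebraic_integer_if_stable[OF S(1,2)]) (auto simp: ring_distribs intro: int_span_add S)
qed

lemma algebraic_integer_mult:
  assumes "algebraic_integer x" "algebraic_integer y" shows "algebraic_integer (x * y)"
proof -
  obtain S where S: "finite S" "1 \<in> S"
    "\<And>s. s \<in> S \<Longrightarrow> x * s \<in> int_span S" "\<And>s. s \<in> S \<Longrightarrow> y * s \<in> int_span S"
    using algebraic_integer_common_module[OF assms] by blast
  show ?thesis
    by (rule algebraic_integer_if_stable[OF S(1,2)]) (auto simp: mult.assoc intro: int_span_mult_stable S)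
qed

lemma algebraic_integer_iff: "algebraic_integer x \<longleftrightarrow> algebraic_int x"
  unfolding algebraic_integer_def algebraic_int_altdef_ipoly by blast

lemma algebraic_integer_of_int: "algebraic_integer (of_int k)"
  unfolding algebraic_integer_iff by (intro int_imp_algebraic_int) auto

lemma algebraic_integer_diff:
  assumes "algebraic_integer x" "algebraic_integer y" shows "algebraic_integer (x - y)"
  using algebraic_integer_add[OF assms(1), of "- y"] assms(2) unfolding algebraic_integer_iff by simp

lemma algebraic_integer_rat:
  assumes "algebraic_integer (of_rat q)" shows "(of_rat q :: complex) \<in> \<int>"
  using rational_algebraic_int_is_int[of "of_rat q :: complex"] assms
  unfolding algebraic_integer_iff by simp

lemma common_denominator:
  assumes "finite (F :: rat set)" shows "\<exists>N :: int. N > 0 \<and> (\<forall>q\<in>F. of_int N * q \<in> \<int>)"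
  using assms
proof (induction F)
  case empty show ?case by (intro exI[of _ 1]) auto
next
  case (insert q F)
  then obtain N :: int where N: "N > 0" "\<And>q. q \<in> F \<Longrightarrow> of_int N * q \<in> \<int>" by blast
  obtain a b where q: "quotient_of q = (a, b)" by fastforce
  then have b: "b > 0" "q = of_int a / of_int b" by (auto dest: quotient_of_denom_pos quotient_of_div)
  show ?case
  proof (intro exI[of _ "N * b"] conjI ballI)
    show "N * b > 0" using N b by simp
    fix r assume "r \<in> insert q F"
    then consider "r = q" | "r \<in> F" by blast
    then show "of_int (N * b) * r \<in> \<int>"
    proof cases
      case 1
      then have "of_int (N * b) * r = of_int (N * a)" using b by (simp add: field_simps)
      then show ?thesis by (metis Ints_of_int)
    next
      case 2
      have "of_int b * (of_int N * r) \<in> \<int>" by (rule Ints_mult[OF Ints_of_int N(2)[OF 2]])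
      then show ?thesis by (simp add: mult_ac)
    qed
  qed
qed

section \<open>Discriminants of families in a field\<close>

lemma subfield_C_rat:
  assumes "subfield_C K" shows "of_rat q \<in> K"
proof -
  have nat: "of_nat n \<in> K" for n
    using assms by (induction n) (auto simp: subfield_C_def)
  have int: "of_int k \<in> K" for k
    using nat assms by (cases k) (auto simp: subfield_C_def simp del: of_nat_Suc)
  obtain a b where q: "quotient_of q = (a, b)" by fastforce
  then have "b > 0" "q = of_int a / of_int b" by (auto dest: quotient_of_denom_pos quotient_of_div)
  moreover from this have "of_rat q = (of_rat (of_int a) :: complex) / of_rat (of_int b)"
    by (simp only: of_rat_divide)
  ultimately have "of_rat q = (of_int a :: complex) * inverse (of_int b)" "(of_int b :: complex) \<noteq> 0"
    by (auto simp: divide_inverse)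
  then show ?thesis using int assms by (simp add: subfield_C_def)
qed

lemma subfield_C_add: "subfield_C K \<Longrightarrow> x \<in> K \<Longrightarrow> y \<in> K \<Longrightarrow> x + y \<in> K"
  and subfield_C_mult: "subfield_C K \<Longrightarrow> x \<in> K \<Longrightarrow> y \<in> K \<Longrightarrow> x * y \<in> K"
  and subfield_C_uminus: "subfield_C K \<Longrightarrow> x \<in> K \<Longrightarrow> - x \<in> K"
  and subfield_C_0: "subfield_C K \<Longrightarrow> 0 \<in> K"
  and subfield_C_1: "subfield_C K \<Longrightarrow> 1 \<in> K"
  by (auto simp: subfield_C_def)

lemma subfield_C_diff: "subfield_C K \<Longrightarrow> x \<in> K \<Longrightarrow> y \<in> K \<Longrightarrow> x - y \<in> K"
  using subfield_C_add[of K x "- y"] subfield_C_uminus[of K y] by simp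

lemma subfield_C_sum: "subfield_C K \<Longrightarrow> (\<And>i. i \<in> I \<Longrightarrow> f i \<in> K) \<Longrightarrow> sum f I \<in> K"
  by (induction I rule: infinite_finite_induct) (auto intro: subfield_C_add subfield_C_0)

lemma subfield_C_power: "subfield_C K \<Longrightarrow> x \<in> K \<Longrightarrow> x ^ n \<in> K"
  by (induction n) (auto intro: subfield_C_mult subfield_C_1)

text \<open>Stands for the trace. Keeping \<open>T\<close> abstract lets the discriminant lemmas be
  applied to an explicit formula before it is known to be rational or to agree with
  \<open>field_trace\<close>.\<close>

definition Q_linear_on :: "complex set \<Rightarrow> (complex \<Rightarrow> complex) \<Rightarrow> bool" where
  "Q_linear_on K T \<longleftrightarrow> (\<forall>x\<in>K. \<forall>y\<in>K. T (x + y) = T x + T y) \<and>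
     (\<forall>q. \<forall>x\<in>K. T (of_rat q * x) = of_rat q * T x)"

lemma Q_linear_on_sum:
  assumes "subfield_C K" "Q_linear_on K T" "\<And>i. i \<in> I \<Longrightarrow> x i \<in> K"
  shows "T (\<Sum>i\<in>I. of_rat (q i) * x i) = (\<Sum>i\<in>I. of_rat (q i) * T (x i))"
proof -
  have T0: "T 0 = 0"
    using assms(2) subfield_C_0[OF assms(1)] unfolding Q_linear_on_def
    by (metis mult_zero_left of_rat_0)
  show ?thesis using assms(3)
  proof (induction I rule: infinite_finite_induct)
    case (insert i I)
    then have "(\<Sum>i\<in>I. of_rat (q i) * x i) \<in> K" "of_rat (q i) * x i \<in> K"
      using assms(1) by (auto intro!: subfield_C_sum subfield_C_mult subfield_C_rat)
    then show ?case using insert assms(2) by (simp add: Q_linear_on_def)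
  qed (auto simp: T0)
qed

definition gram_det :: "(complex \<Rightarrow> complex) \<Rightarrow> nat \<Rightarrow> (nat \<Rightarrow> complex) \<Rightarrow> complex" where
  "gram_det T n v = det (mat n n (\<lambda>(i, j). T (v i * v j)))"

text \<open>By bilinearity the Gram matrix of \<open>v\<close> is P G P^T, where \<open>P\<close> is
  the transition matrix and \<open>G\<close> the Gram matrix of \<open>b\<close>.\<close>

lemma gram_det_change_basis:
  fixes A :: "nat \<Rightarrow> nat \<Rightarrow> rat"
  assumes K: "subfield_C K" and T: "Q_linear_on K T" and b: "\<And>i. i < n \<Longrightarrow> b i \<in> K"
    and v: "\<And>i. i < n \<Longrightarrow> v i = (\<Sum>k<n. of_rat (A i k) * b k)"
  shows "gram_det T n v = (of_rat (det (mat n n (\<lambda>(i, j). A i j))))\<^sup>2 * gram_det T n b"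
proof -
  define P :: "complex mat" where "P = map_mat of_rat (mat n n (\<lambda>(i, j). A i j))"
  define G where "G = mat n n (\<lambda>(i, j). T (b i * b j))"
  have P: "P \<in> carrier_mat n n" and G: "G \<in> carrier_mat n n" by (auto simp: P_def G_def)
  have vK: "v i \<in> K" if "i < n" for i
    using that K b by (auto simp: v intro!: subfield_C_sum subfield_C_mult subfield_C_rat)
  have Tl: "T (v i * y) = (\<Sum>k<n. of_rat (A i k) * T (b k * y))" if "i < n" "y \<in> K" for i y
  proof -
    have "v i * y = (\<Sum>k<n. of_rat (A i k) * (b k * y))"
      by (simp add: v[OF that(1)] sum_distrib_right mult.assoc)
    then show ?thesis
      using Q_linear_on_sum[OF K T, of "{..<n}" "\<lambda>k. b k * y" "A i"] b K that
      by (simp add: subfield_C_mult)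
  qed
  have "mat n n (\<lambda>(i, j). T (v i * v j)) = P * (G * transpose_mat P)"
  proof (rule eq_matI)
    fix i j assume "i < dim_row (P * (G * transpose_mat P))" "j < dim_col (P * (G * transpose_mat P))"
    then have ij: "i < n" "j < n" using P by auto
    have "T (v i * v j) = (\<Sum>k<n. of_rat (A i k) * T (v j * b k))"
      using Tl[OF ij(1) vK[OF ij(2)]] by (simp add: mult.commute)
    also have "\<dots> = (\<Sum>k<n. of_rat (A i k) * (\<Sum>l<n. of_rat (A j l) * T (b k * b l)))"
      using Tl[OF ij(2)] b by (intro sum.cong) (auto simp: mult.commute)
    finally show "mat n n (\<lambda>(i, j). T (v i * v j)) $$ (i, j) = (P * (G * transpose_mat P)) $$ (i, j)"
      using ij by (simp add: P_def G_def scalar_prod_def lessThan_atLeast0 mult.commute)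
  qed (use P in auto)
  then have "gram_det T n v = det P * (det G * det (transpose_mat P))"
    unfolding gram_det_def using P G by (simp add: det_mult[of _ n])
  then show ?thesis
    unfolding det_transpose[OF P] by (simp add: gram_det_def G_def P_def power2_eq_square)
qed

text \<open>Multiplying a rational relation by each \<open>v j\<close> and applying \<open>T\<close>
  shows that its coefficient vector lies in the kernel of the Gram matrix.\<close>

lemma gram_det_nonzero_imp_independent:
  fixes e :: "nat \<Rightarrow> rat"
  assumes K: "subfield_C K" and T: "Q_linear_on K T" and v: "\<And>i. i < n \<Longrightarrow> v i \<in> K"
    and nz: "gram_det T n v \<noteq> 0" and e: "(\<Sum>i<n. of_rat (e i) * v i) = 0" and k: "k < n"
  shows "e k = 0"
proof (rule ccontr)
  assume "e k \<noteq> 0"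
  define G where "G = mat n n (\<lambda>(i, j). T (v i * v j))"
  define w :: "complex vec" where "w = vec n (\<lambda>i. of_rat (e i))"
  have G: "G \<in> carrier_mat n n" and w: "w \<in> carrier_vec n" by (auto simp: G_def w_def)
  have "w \<noteq> 0\<^sub>v n"
  proof
    assume "w = 0\<^sub>v n"
    then have "w $ k = 0\<^sub>v n $ k" by simp
    then show False using k \<open>e k \<noteq> 0\<close> by (simp add: w_def)
  qed
  moreover have "G *\<^sub>v w = 0\<^sub>v n"
  proof (rule eq_vecI)
    fix j assume "j < dim_vec (0\<^sub>v n)"
    then have j: "j < n" by simp
    have "(\<Sum>i<n. of_rat (e i) * (v j * v i)) = v j * (\<Sum>i<n. of_rat (e i) * v i)"
      by (simp add: sum_distrib_left mult_ac)
    then have "T (\<Sum>i<n. of_rat (e i) * (v j * v i)) = T 0" using e by simp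
    moreover have "T 0 = 0" using Q_linear_on_sum[OF K T, of "{}"] by simp
    moreover have "T (\<Sum>i<n. of_rat (e i) * (v j * v i)) = (\<Sum>i<n. of_rat (e i) * T (v j * v i))"
      using v j K by (intro Q_linear_on_sum[OF K T]) (auto intro: subfield_C_mult)
    ultimately have "(\<Sum>i<n. of_rat (e i) * T (v j * v i)) = 0" by simp
    then show "(G *\<^sub>v w) $ j = 0\<^sub>v n $ j"
      using j by (simp add: G_def w_def scalar_prod_def lessThan_atLeast0 mult.commute)
  qed (use G in auto)
  ultimately have "det G = 0" using det_0_iff_vec_prod_zero[OF G] w by blast
  then show False using nz by (simp add: gram_det_def G_def)
qed

text \<open>The change of basis formula forces the transition matrix from \<open>b\<close> to
  \<open>v\<close> to be invertible, so \<open>v\<close> spans. Uniqueness of coordinates is the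
  independence just shown. This turns every nonzero discriminant computed below into a
  basis.\<close>

lemma Q_basis_if_gram_det_nonzero:
  assumes K: "subfield_C K" and T: "Q_linear_on K T" and b: "Q_basis K b n"
    and v: "\<And>i. i < n \<Longrightarrow> v i \<in> K" and nz: "gram_det T n v \<noteq> 0"
  shows "Q_basis K v n"
proof -
  have bK: "\<And>i. i < n \<Longrightarrow> b i \<in> K" using b by (auto simp: Q_basis_def)
  have span: "\<exists>c :: nat \<Rightarrow> rat. x = (\<Sum>i<n. of_rat (c i) * b i)" if "x \<in> K" for x
    using b that unfolding Q_basis_def by blast
  then have "\<forall>i. \<exists>c :: nat \<Rightarrow> rat. i < n \<longrightarrow> v i = (\<Sum>k<n. of_rat (c k) * b k)" using v by blast
  then obtain A :: "nat \<Rightarrow> nat \<Rightarrow> rat" where A: "\<And>i. i < n \<Longrightarrow> v i = (\<Sum>k<n. of_rat (A i k) * b k)"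
    by metis
  define M where "M = mat n n (\<lambda>(i, j). A i j)"
  have M: "M \<in> carrier_mat n n" by (simp add: M_def)
  have detM: "det M \<noteq> 0"
    using gram_det_change_basis[OF K T bK A] nz by (auto simp: M_def)
  define B where "B = (1 / det M) \<cdot>\<^sub>m adj_mat M"
  have B: "B \<in> carrier_mat n n" using adj_mat(1)[OF M] by (simp add: B_def)
  have "B * M = (1 / det M) \<cdot>\<^sub>m (adj_mat M * M)"
    unfolding B_def using adj_mat(1)[OF M] M by (intro mult_smult_assoc_mat) auto
  also have "\<dots> = 1\<^sub>m n"
    using adj_mat(3)[OF M] detM by (auto intro!: eq_matI)
  finally have BM: "B * M = 1\<^sub>m n" .
  have bv: "b k = (\<Sum>i<n. of_rat (B $$ (k, i)) * v i)" if k: "k < n" for k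
  proof -
    have ent: "(\<Sum>i<n. B $$ (k, i) * A i l) = (if k = l then 1 else 0)" if l: "l < n" for l
    proof -
      have "(B * M) $$ (k, l) = (\<Sum>i<n. B $$ (k, i) * A i l)"
        using B M k l by (simp add: scalar_prod_def lessThan_atLeast0 M_def)
      then show ?thesis unfolding BM using k l by simp
    qed
    have "(\<Sum>i<n. of_rat (B $$ (k, i)) * v i)
        = (\<Sum>i<n. \<Sum>l<n. of_rat (B $$ (k, i) * A i l) * b l)"
      by (intro sum.cong) (auto simp: A sum_distrib_left of_rat_mult mult.assoc)
    also have "\<dots> = (\<Sum>l<n. \<Sum>i<n. of_rat (B $$ (k, i) * A i l) * b l)" by (rule sum.swap)
    also have "\<dots> = (\<Sum>l<n. of_rat (\<Sum>i<n. B $$ (k, i) * A i l) * b l)"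
      by (simp add: sum_distrib_right of_rat_sum)
    also have "\<dots> = (\<Sum>l<n. if k = l then b l else 0)"
      by (intro sum.cong) (auto simp: ent)
    finally show ?thesis using k by simp
  qed
  show ?thesis unfolding Q_basis_def
  proof (intro conjI ballI allI impI)
    fix x assume "x \<in> K"
    then obtain c :: "nat \<Rightarrow> rat" where c: "x = (\<Sum>k<n. of_rat (c k) * b k)" using span by blast
    \<comment> \<open>Coordinates from index \<open>n\<close> on are set to 0, as
      \<open>Q_basis\<close> demands; otherwise they would not be unique.\<close>
    define d where "d i = (if i < n then \<Sum>k<n. c k * B $$ (k, i) else 0)" for i
    have "x = (\<Sum>k<n. \<Sum>i<n. of_rat (c k * B $$ (k, i)) * v i)"
      unfolding c by (intro sum.cong) (auto simp: bv sum_distrib_left of_rat_mult mult.assoc)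
    also have "\<dots> = (\<Sum>i<n. \<Sum>k<n. of_rat (c k * B $$ (k, i)) * v i)" by (rule sum.swap)
    also have "\<dots> = (\<Sum>i<n. of_rat (d i) * v i)"
      by (intro sum.cong) (auto simp: d_def sum_distrib_right of_rat_sum)
    finally have d: "x = (\<Sum>i<n. of_rat (d i) * v i)" .
    show "\<exists>!c. (\<forall>i\<ge>n. c i = 0) \<and> x = (\<Sum>i<n. of_rat (c i) * v i)"
    proof (rule ex1I[of _ d])
      show "(\<forall>i\<ge>n. d i = 0) \<and> x = (\<Sum>i<n. of_rat (d i) * v i)" using d by (simp add: d_def)
      fix c :: "nat \<Rightarrow> rat" assume c: "(\<forall>i\<ge>n. c i = 0) \<and> x = (\<Sum>i<n. of_rat (c i) * v i)"
      then have "(\<Sum>i<n. of_rat (c i - d i) * v i) = 0"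
        using d by (simp add: of_rat_diff left_diff_distrib sum_subtractf)
      then have "c i - d i = 0" if "i < n" for i
        using gram_det_nonzero_imp_independent[OF K T v nz, of "\<lambda>i. c i - d i" i] that by blast
      then show "c = d" using c by (intro ext) (metis d_def eq_iff_diff_eq_0 not_less)
    qed
  qed (use v in auto)
qed

lemma Ints_det:
  fixes A :: "complex mat"
  assumes "A \<in> carrier_mat n n" "\<And>i j. i < n \<Longrightarrow> j < n \<Longrightarrow> A $$ (i, j) \<in> \<int>"
  shows "det A \<in> \<int>"
proof -
  have "(\<Prod>i = 0..<n. A $$ (i, p i)) \<in> \<int>" if "p permutes {0..<n}" for p
    using assms(2) permutes_in_image[OF that] by (intro Ints_prod) auto
  moreover have "(signof p :: complex) \<in> \<int>" for p by (simp add: sign_def)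
  ultimately show ?thesis
    unfolding det_def'[OF assms(1)] by (intro Ints_sum Ints_mult) auto
qed

text \<open>After transposition this is Cramer's rule for the identity matrix. It gives the factor
  by which exchanging a single basis vector changes the volume.\<close>

lemma det_replaced_identity_row:
  fixes c :: "nat \<Rightarrow> 'a :: idom"
  assumes "k < n"
  shows "det (mat n n (\<lambda>(i, j). if i = k then c j else if i = j then 1 else 0)) = c k" (is "det ?A = _")
proof -
  have "transpose_mat ?A = replace_col (1\<^sub>m n) (1\<^sub>m n *\<^sub>v vec n c) k"
    by (rule eq_matI) (auto simp: replace_col_def)
  moreover have "det (replace_col (1\<^sub>m n) (1\<^sub>m n *\<^sub>v vec n c) k) = vec n c $ k * det (1\<^sub>m n)"
    using assms by (intro cramer_lemma_mat) auto
  ultimately have "det (transpose_mat ?A) = c k" using assms by simp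
  then show ?thesis by (simp add: det_transpose[of _ n])
qed

section \<open>Integral bases\<close>

lemma ring_of_integers_mult:
  "subfield_C K \<Longrightarrow> x \<in> ring_of_integers K \<Longrightarrow> y \<in> ring_of_integers K \<Longrightarrow> x * y \<in> ring_of_integers K"
  by (auto simp: ring_of_integers_def intro: subfield_C_mult algebraic_integer_mult)

lemma ring_of_integers_of_int: "subfield_C K \<Longrightarrow> of_int k \<in> ring_of_integers K"
  using subfield_C_rat[of K "of_int k"] by (auto simp: ring_of_integers_def intro: algebraic_integer_of_int)

lemma ring_of_integers_diff:
  "subfield_C K \<Longrightarrow> x \<in> ring_of_integers K \<Longrightarrow> y \<in> ring_of_integers K \<Longrightarrow> x - y \<in> ring_of_integers K"
  by (auto simp: ring_of_integers_def intro: subfield_C_diff algebraic_integer_diff)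

text \<open>Take for \<open>N\<close> a common denominator of the matrix of multiplication by
  \<open>x\<close>. Then \<open>N * x\<close> maps the integral span of the basis into itself, and
  the determinant trick applies.\<close>

lemma integral_multiple_exists:
  assumes K: "subfield_C K" and b: "Q_basis K b n" and x: "x \<in> K"
  obtains N :: int where "N > 0" "of_int N * x \<in> ring_of_integers K"
proof -
  have bK: "\<And>i. i < n \<Longrightarrow> b i \<in> K" using b by (auto simp: Q_basis_def)
  have span: "\<exists>c :: nat \<Rightarrow> rat. y = (\<Sum>i<n. of_rat (c i) * b i)" if "y \<in> K" for y
    using b that unfolding Q_basis_def by blast
  then have "\<forall>i. \<exists>c :: nat \<Rightarrow> rat. i < n \<longrightarrow> x * b i = (\<Sum>k<n. of_rat (c k) * b k)"
    using bK subfield_C_mult[OF K x] by blast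
  then obtain A :: "nat \<Rightarrow> nat \<Rightarrow> rat"
    where A: "\<And>i. i < n \<Longrightarrow> x * b i = (\<Sum>k<n. of_rat (A i k) * b k)"
    by metis
  have "finite ((\<lambda>(i, k). A i k) ` ({..<n} \<times> {..<n}))" by simp
  then obtain N :: int where N: "N > 0"
    "\<And>q. q \<in> (\<lambda>(i, k). A i k) ` ({..<n} \<times> {..<n}) \<Longrightarrow> of_int N * q \<in> \<int>"
    using common_denominator by meson
  have NA: "of_int N * A i k \<in> \<int>" if "i < n" "k < n" for i k
    using that by (intro N(2)) auto
  have "\<exists>i<n. b i \<noteq> 0"
  proof (rule ccontr)
    assume "\<not> ?thesis"
    then have "y = 0" if "y \<in> K" for y using span[OF that] by force
    then show False using subfield_C_1[OF K] by force
  qed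
  then obtain i0 where i0: "i0 < n" "b i0 \<noteq> 0" by blast
  define S where "S = b ` {..<n}"
  have fin: "finite S" by (simp add: S_def)
  have "algebraic_integer (of_int N * x)"
  proof (rule algebraic_integer_if_stable[OF fin, of "b i0"])
    fix s assume "s \<in> S"
    then obtain i where i: "i < n" "s = b i" by (auto simp: S_def)
    have "of_int N * x * s = (\<Sum>k<n. of_rat (of_int N * A i k) * b k)"
      using A[OF i(1)] i(2) by (simp add: sum_distrib_left of_rat_mult mult.assoc)
    moreover have "of_rat (of_int N * A i k) * b k \<in> int_span S" if k: "k < n" for k
    proof -
      obtain m :: int where "of_int N * A i k = of_int m" using NA[OF i(1) k] by (auto elim: Ints_cases)
      moreover have "b k \<in> S" using k by (auto simp: S_def)
      ultimately show ?thesis using int_span_of_int_mult[OF int_span_base[OF fin]] by simp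
    qed
    ultimately show "of_int N * x * s \<in> int_span S" by (auto intro: int_span_sum)
  qed (use i0 in \<open>auto simp: S_def\<close>)
  moreover have "of_int N * x \<in> K"
    using subfield_C_mult[OF K _ x] ring_of_integers_of_int[OF K, of N] by (simp add: ring_of_integers_def)
  ultimately show ?thesis using that N(1) by (simp add: ring_of_integers_def)
qed

lemma gram_det_Ints:
  assumes "subfield_C K" "\<And>x. x \<in> ring_of_integers K \<Longrightarrow> T x \<in> \<int>"
    and "\<And>i. i < n \<Longrightarrow> v i \<in> ring_of_integers K"
  shows "gram_det T n v \<in> \<int>"
  unfolding gram_det_def using assms by (intro Ints_det[of _ n]) (auto intro: ring_of_integers_mult)

lemma cmod_Ints_ge_1:
  assumes "z \<in> \<int>" "z \<noteq> 0" shows "1 \<le> cmod z"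
proof -
  obtain k :: int where "z = of_int k" using assms by (auto elim: Ints_cases)
  then have "cmod z = of_int \<bar>k\<bar>" "1 \<le> \<bar>k\<bar>" using assms by auto
  then show ?thesis by (metis of_int_1_le_iff)
qed

text \<open>An independent family of integers of minimal discriminant is an integral basis: a
  non-integral coordinate \<open>c k\<close> of an integer \<open>x\<close> would allow replacing \<open>v k\<close> by
  \<open>x - \<lfloor>c k\<rfloor> * v k\<close>, which scales the discriminant by the square of the fractional
  part of \<open>c k\<close>.\<close>

lemma integral_basis_exists:
  assumes K: "subfield_C K" and b: "Q_basis K b (field_degree K)" and T: "Q_linear_on K T"
    and TZ: "\<And>x. x \<in> ring_of_integers K \<Longrightarrow> T x \<in> \<int>"
    and w: "\<And>i. i < field_degree K \<Longrightarrow> w i \<in> ring_of_integers K"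
    and nz: "gram_det T (field_degree K) w \<noteq> 0"
  shows "\<exists>\<omega>. integral_basis K \<omega>"
proof -
  define n where "n = field_degree K"
  define P where "P v \<longleftrightarrow> (\<forall>i<n. v i \<in> ring_of_integers K) \<and> gram_det T n v \<noteq> 0" for v
  have "P w" using w nz by (simp add: P_def n_def)
  \<comment> \<open>Rounding down makes the size of the discriminant a natural number, so that a
    minimum exists. Nothing is lost, since these discriminants are rational integers.\<close>
  then obtain v where v: "P v" and min: "\<And>u. P u \<Longrightarrow> nat \<lfloor>cmod (gram_det T n v)\<rfloor> \<le> nat \<lfloor>cmod (gram_det T n u)\<rfloor>"
    using ex_has_least_nat[of P w "\<lambda>v. nat \<lfloor>cmod (gram_det T n v)\<rfloor>"] by blast
  have vI: "\<And>i. i < n \<Longrightarrow> v i \<in> ring_of_integers K" and vnz: "gram_det T n v \<noteq> 0"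
    using v by (auto simp: P_def)
  have vK: "\<And>i. i < n \<Longrightarrow> v i \<in> K" using vI by (auto simp: ring_of_integers_def)
  have min': "cmod (gram_det T n v) \<le> cmod (gram_det T n u)" if u: "P u" for u
  proof -
    have fl: "real (nat \<lfloor>cmod (gram_det T n u)\<rfloor>) = cmod (gram_det T n u)" if "P u" for u
    proof -
      have "gram_det T n u \<in> \<int>" using that TZ K by (intro gram_det_Ints) (auto simp: P_def)
      then show ?thesis by (elim Ints_cases) simp
    qed
    show ?thesis using min[OF u] fl[OF u] fl[OF v] by (metis of_nat_le_iff)
  qed
  have basis: "Q_basis K v n"
    using Q_basis_if_gram_det_nonzero[OF K T b] vK vnz by (auto simp: n_def)
  have uniq: "c = d" if "\<forall>i\<ge>n. c i = 0" "\<forall>i\<ge>n. d i = 0" "x \<in> K"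
    "x = (\<Sum>i<n. of_rat (c i) * v i)" "x = (\<Sum>i<n. of_rat (d i) * v i)" for x and c d :: "nat \<Rightarrow> rat"
    using basis that unfolding Q_basis_def by blast
  have int: "c k \<in> \<int>" if x: "x \<in> ring_of_integers K" "x = (\<Sum>i<n. of_rat (c i) * v i)" and k: "k < n"
    for x k and c :: "nat \<Rightarrow> rat"
  proof (rule ccontr)
    assume nonint: "c k \<notin> \<int>"
    define f where "f = frac (c k)"
    have f: "0 < f" "f < 1" using nonint frac_lt_1[of "c k"] by (auto simp: f_def frac_gt_0_iff)
    define u where "u = v(k := x - of_int \<lfloor>c k\<rfloor> * v k)"
    \<comment> \<open>The transition matrix from \<open>v\<close> to \<open>u\<close>: the identity
      except in row \<open>k\<close>, which holds the coordinates of \<open>x\<close> with the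
      \<open>k\<close>-th reduced to its fractional part.\<close>
    define A where "A i j = (if i = k then (c(k := f)) j else if i = j then 1 else 0)" for i j
    have uI: "u i \<in> ring_of_integers K" if "i < n" for i
      using vI that x k unfolding u_def
      by (auto intro!: ring_of_integers_diff ring_of_integers_mult ring_of_integers_of_int K)
    have "u i = (\<Sum>j<n. of_rat (A i j) * v j)" if i: "i < n" for i
    proof (cases "i = k")
      case True
      have "u k = (\<Sum>j<n. of_rat (c j) * v j) - (\<Sum>j<n. (if j = k then of_int \<lfloor>c k\<rfloor> * v k else 0))"
        using x k by (simp add: u_def)
      also have "\<dots> = (\<Sum>j<n. of_rat (A k j) * v j)"
        unfolding sum_subtractf[symmetric]
        by (intro sum.cong) (auto simp: A_def f_def frac_def of_rat_diff left_diff_distrib)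
      finally show ?thesis using True by simp
    next
      case False
      have "(\<Sum>j<n. of_rat (A i j) * v j) = (\<Sum>j<n. if j = i then v j else 0)"
        using False by (intro sum.cong) (auto simp: A_def)
      then show ?thesis using i False by (simp add: u_def)
    qed
    then have "gram_det T n u = (of_rat (det (mat n n (\<lambda>(i, j). A i j))))\<^sup>2 * gram_det T n v"
      by (intro gram_det_change_basis[OF K T vK]) auto
    also have "det (mat n n (\<lambda>(i, j). A i j)) = f"
      using det_replaced_identity_row[OF k, of "c(k := f)"] by (simp add: A_def)
    finally have gu: "gram_det T n u = (of_rat f)\<^sup>2 * gram_det T n v" .
    then have "P u" using uI f vnz by (simp add: P_def)
    then have "cmod (gram_det T n v) \<le> cmod (gram_det T n u)" by (rule min')
    also have "\<dots> = (of_rat f)\<^sup>2 * cmod (gram_det T n v)"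
    proof -
      have "(of_rat f :: complex) = of_real (of_rat f)" by (cases f) (simp add: of_rat_rat)
      then show ?thesis unfolding gu using f by (simp add: norm_mult norm_power)
    qed
    also have "\<dots> < 1 * cmod (gram_det T n v)"
      using f vnz by (intro mult_strict_right_mono) (auto simp: power_less_one_iff)
    finally show False by simp
  qed
  have "integral_basis K v"
    unfolding integral_basis_def n_def[symmetric]
  proof (intro conjI allI impI ballI)
    fix x assume x: "x \<in> ring_of_integers K"
    then have xK: "x \<in> K" by (simp add: ring_of_integers_def)
    then obtain c :: "nat \<Rightarrow> rat" where c: "\<forall>i\<ge>n. c i = 0" "x = (\<Sum>i<n. of_rat (c i) * v i)"
      using basis unfolding Q_basis_def by blast
    have "c i \<in> \<int>" for i using int[OF x c(2), of i] c(1) by (cases "i < n") auto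
    then have fl: "of_int \<lfloor>c i\<rfloor> = c i" for i by (metis Ints_cases floor_of_int)
    show "\<exists>!c :: nat \<Rightarrow> int. (\<forall>i\<ge>n. c i = 0) \<and> x = (\<Sum>i<n. of_int (c i) * v i)"
    proof (rule ex1I[of _ "\<lambda>i. \<lfloor>c i\<rfloor>"])
      have "(of_int \<lfloor>c i\<rfloor> :: complex) = of_rat (c i)" for i by (metis fl of_rat_of_int_eq)
      then show "(\<forall>i\<ge>n. \<lfloor>c i\<rfloor> = 0) \<and> x = (\<Sum>i<n. of_int \<lfloor>c i\<rfloor> * v i)" using c by simp
      fix d :: "nat \<Rightarrow> int" assume d: "(\<forall>i\<ge>n. d i = 0) \<and> x = (\<Sum>i<n. of_int (d i) * v i)"
      then have "(\<lambda>i. of_int (d i)) = c" using c xK by (intro uniq) auto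
      then show "d = (\<lambda>i. \<lfloor>c i\<rfloor>)" by (metis floor_of_int)
    qed
  qed (use vI in auto)
  then show ?thesis by blast
qed

text \<open>The transition matrix from \<omega> to \<open>v\<close> is integral, so its determinant
  is an integer. It is nonzero because the discriminant of \<open>v\<close> is, and its square is
  therefore at least 1.\<close>

lemma integral_basis_gram_det_le:
  assumes K: "subfield_C K" and T: "Q_linear_on K T" and \<omega>: "integral_basis K \<omega>"
    and v: "\<And>i. i < field_degree K \<Longrightarrow> v i \<in> ring_of_integers K"
    and nz: "gram_det T (field_degree K) v \<noteq> 0"
  shows "cmod (gram_det T (field_degree K) \<omega>) \<le> cmod (gram_det T (field_degree K) v)"
proof -
  define n where "n = field_degree K"
  have "\<forall>i. \<exists>c :: nat \<Rightarrow> int. i < n \<longrightarrow> v i = (\<Sum>k<n. of_int (c k) * \<omega> k)"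
    using \<omega> v unfolding integral_basis_def n_def by blast
  then obtain A :: "nat \<Rightarrow> nat \<Rightarrow> int" where A: "\<And>i. i < n \<Longrightarrow> v i = (\<Sum>k<n. of_int (A i k) * \<omega> k)"
    by metis
  define D :: rat where "D = det (mat n n (\<lambda>(i, j). of_int (A i j)))"
  have "mat n n (\<lambda>(i, j). of_int (A i j) :: rat) = map_mat of_int (mat n n (\<lambda>(i, j). A i j))"
    by (auto intro!: eq_matI)
  then have "D = of_int (det (mat n n (\<lambda>(i, j). A i j)))" unfolding D_def by simp
  then have DZ: "(of_rat D :: complex) \<in> \<int>" by simp
  have gv: "gram_det T n v = (of_rat D)\<^sup>2 * gram_det T n \<omega>"
    unfolding D_def using \<omega> A
    by (intro gram_det_change_basis[OF K T]) (auto simp: integral_basis_def ring_of_integers_def n_def)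
  then have "of_rat D \<noteq> (0 :: complex)" using nz by (auto simp: n_def)
  then have "1 \<le> cmod (of_rat D)" using DZ cmod_Ints_ge_1 by blast
  then have "1 * cmod (gram_det T n \<omega>) \<le> (cmod (of_rat D))\<^sup>2 * cmod (gram_det T n \<omega>)"
    by (intro mult_right_mono one_le_power) auto
  then show ?thesis using gv by (simp add: norm_mult norm_power n_def)
qed

section \<open>Field homomorphisms\<close>

text \<open>Differs from \<open>embeddings\<close> by leaving the values outside \<open>K\<close>
  free, so that complex conjugation and the iterates of \<sigma> qualify as they stand.\<close>

definition hom_on :: "complex set \<Rightarrow> (complex \<Rightarrow> complex) \<Rightarrow> bool" where
  "hom_on K \<tau> \<longleftrightarrow> \<tau> 1 = 1 \<and>
     (\<forall>x\<in>K. \<forall>y\<in>K. \<tau> (x + y) = \<tau> x + \<tau> y \<and> \<tau> (x * y) = \<tau> x * \<tau> y)"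

lemma hom_on_1: "hom_on K \<tau> \<Longrightarrow> \<tau> 1 = 1"
  and hom_on_add: "hom_on K \<tau> \<Longrightarrow> x \<in> K \<Longrightarrow> y \<in> K \<Longrightarrow> \<tau> (x + y) = \<tau> x + \<tau> y"
  and hom_on_mult: "hom_on K \<tau> \<Longrightarrow> x \<in> K \<Longrightarrow> y \<in> K \<Longrightarrow> \<tau> (x * y) = \<tau> x * \<tau> y"
  by (auto simp: hom_on_def)

lemma hom_on_0: "subfield_C K \<Longrightarrow> hom_on K \<tau> \<Longrightarrow> \<tau> 0 = 0"
  using hom_on_add[of K \<tau> 0 0] subfield_C_0[of K] by simp

lemma hom_on_uminus:
  assumes "subfield_C K" "hom_on K \<tau>" "x \<in> K" shows "\<tau> (- x) = - \<tau> x"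
  using hom_on_add[OF assms(2,3) subfield_C_uminus[OF assms(1,3)]] hom_on_0[OF assms(1,2)]
  by (simp add: eq_neg_iff_add_eq_0 add.commute)

lemma hom_on_diff:
  assumes "subfield_C K" "hom_on K \<tau>" "x \<in> K" "y \<in> K" shows "\<tau> (x - y) = \<tau> x - \<tau> y"
  using hom_on_add[OF assms(2,3) subfield_C_uminus[OF assms(1,4)]] hom_on_uminus[OF assms(1,2,4)] by simp

lemma hom_on_power:
  assumes "subfield_C K" "hom_on K \<tau>" "x \<in> K" shows "\<tau> (x ^ n) = \<tau> x ^ n"
  by (induction n) (simp_all add: assms hom_on_1[OF assms(2)] hom_on_mult[OF assms(2)] subfield_C_power)

lemma hom_on_of_int:
  assumes K: "subfield_C K" and \<tau>: "hom_on K \<tau>" shows "\<tau> (of_int k) = of_int k"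
proof -
  have K_int: "of_int m \<in> K" for m using subfield_C_rat[OF K, of "of_int m"] by simp
  have nat: "\<tau> (of_nat n) = of_nat n" for n
  proof (induction n)
    case (Suc n)
    then show ?case
      using hom_on_add[OF \<tau> subfield_C_1[OF K] K_int[of "int n"]] hom_on_1[OF \<tau>] by simp
  qed (simp add: hom_on_0[OF K \<tau>])
  show ?thesis
  proof (cases "k \<ge> 0")
    case True
    then show ?thesis using nat[of "nat k"] by simp
  next
    case False
    then show ?thesis using nat[of "nat (- k)"] hom_on_uminus[OF K \<tau> K_int[of "- k"]] by simp
  qed
qed

lemma hom_on_of_rat:
  assumes K: "subfield_C K" and \<tau>: "hom_on K \<tau>" shows "\<tau> (of_rat q) = of_rat q"
proof -
  obtain a b where q: "quotient_of q = (a, b)" by fastforce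
  then have "b > 0" "q = of_int a / of_int b" by (auto dest: quotient_of_denom_pos quotient_of_div)
  then have "q * of_int b = of_int a" by simp
  then have eq: "of_rat q * of_int b = (of_int a :: complex)" by (metis of_rat_mult of_rat_of_int_eq)
  have "\<tau> (of_rat q) * of_int b = \<tau> (of_rat q * of_int b)"
    using hom_on_mult[OF \<tau> subfield_C_rat[OF K] subfield_C_rat[OF K, of "of_int b"]] hom_on_of_int[OF K \<tau>]
    by simp
  also have "\<dots> = of_rat q * of_int b" unfolding eq by (rule hom_on_of_int[OF K \<tau>])
  finally show ?thesis using \<open>b > 0\<close> by simp
qed

lemma hom_on_poly:
  fixes p :: "int poly"
  assumes K: "subfield_C K" and \<tau>: "hom_on K \<tau>" and x: "x \<in> K"
  shows "\<tau> (poly (map_poly of_int p) x) = poly (map_poly of_int p) (\<tau> x)"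
proof -
  have K_int: "of_int m \<in> K" for m using subfield_C_rat[OF K, of "of_int m"] by simp
  have pK: "poly (map_poly of_int q) x \<in> K" for q :: "int poly"
    by (induction q) (auto simp: map_poly_pCons K_int intro!: subfield_C_0 subfield_C_add subfield_C_mult K x)
  show ?thesis
    by (induction p) (simp_all add: map_poly_pCons hom_on_0[OF K \<tau>] hom_on_add[OF \<tau>] hom_on_mult[OF \<tau>]
      hom_on_of_int[OF K \<tau>] subfield_C_mult[OF K] K_int pK x)
qed

lemma hom_on_algebraic_integer:
  assumes "subfield_C K" "hom_on K \<tau>" "x \<in> K" "algebraic_integer x"
  shows "algebraic_integer (\<tau> x)"
  using assms hom_on_poly[OF assms(1-3)] hom_on_0[OF assms(1,2)] unfolding algebraic_integer_def by metis

section \<open>Gram determinants that split into two blocks\<close>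

lemma det_2_by_2:
  fixes A :: "'a :: comm_ring_1 mat"
  assumes A: "A \<in> carrier_mat 2 2"
  shows "det A = A $$ (0, 0) * A $$ (1, 1) - A $$ (0, 1) * A $$ (1, 0)"
proof -
  have "det A = (\<Sum>i<2. A $$ (i, 0) * cofactor A i 0)"
    using laplace_expansion_column[OF A, of 0] by simp
  also have "\<dots> = A $$ (0, 0) * det (mat_delete A 0 0) - A $$ (1, 0) * det (mat_delete A 1 0)"
    by (simp add: numeral_2_eq_2 cofactor_def)
  also have "det (mat_delete A 0 0) = A $$ (1, 1)" using A
    by (subst det_single) (auto simp: mat_delete_def)
  also have "det (mat_delete A 1 0) = A $$ (0, 1)" using A
    by (subst det_single) (auto simp: mat_delete_def)
  finally show ?thesis by (simp add: mult.commute)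
qed

text \<open>Meant for a pair \<open>a\<close>, \<open>b\<close> fixed by the square of \<sigma> and
  a pair \<open>c\<close>, \<open>d\<close> negated by it: mixed products are negated and have trace
  0, so the Gram matrix is block diagonal.\<close>

lemma gram_det_block:
  fixes T :: "complex \<Rightarrow> complex"
  assumes "T (a * c) = 0" "T (a * d) = 0" "T (b * c) = 0" "T (b * d) = 0"
  shows "gram_det T 4 (\<lambda>i. [a, b, c, d] ! i)
    = (T (a * a) * T (b * b) - T (a * b) ^ 2) * (T (c * c) * T (d * d) - T (c * d) ^ 2)"
proof -
  let ?M = "\<lambda>x y. mat 2 2 (\<lambda>(i, j). T ([x, y] ! i * [x, y] ! j))"
  have lt4: "i < 4 \<Longrightarrow> i = 0 \<or> i = 1 \<or> i = 2 \<or> i = (3::nat)" for i by linarith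
  have "mat 4 4 (\<lambda>(i, j). T ([a, b, c, d] ! i * [a, b, c, d] ! j))
    = four_block_mat (?M a b) (0\<^sub>m 2 2) (0\<^sub>m 2 2) (?M c d)"
    (is "?L = ?R")
  proof (rule eq_matI)
    fix i j assume "i < dim_row ?R" "j < dim_col ?R"
    then have ij: "i < 4" "j < 4" by simp_all
    show "?L $$ (i, j) = ?R $$ (i, j)"
      using lt4[OF ij(1)] lt4[OF ij(2)] assms by (elim disjE) (simp_all add: mult.commute)
  qed simp_all
  then have "gram_det T 4 (\<lambda>i. [a, b, c, d] ! i) = det (?M a b) * det (?M c d)"
    unfolding gram_det_def
    using det_four_block_mat_upper_right_zero[of "?M a b" 2 "0\<^sub>m 2 2" 2 "0\<^sub>m 2 2" "?M c d"]
    by simp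
  then show ?thesis by (simp add: det_2_by_2 power2_eq_square mult.commute)
qed

section \<open>Cyclic quartic fields\<close>

text \<open>The algebra of a generator of the Galois group, for real and imaginary fields alike;
  total imaginarity enters only after the embeddings have been classified.\<close>

locale cyclic_quartic_automorphism =
  fixes K :: "complex set" and \<sigma> :: "complex \<Rightarrow> complex" and b :: "nat \<Rightarrow> complex"
  assumes K: "subfield_C K" and basis: "Q_basis K b 4" and hom: "hom_on K \<sigma>"
    and closed: "\<And>x. x \<in> K \<Longrightarrow> \<sigma> x \<in> K"
    and order4: "\<And>x. x \<in> K \<Longrightarrow> \<sigma> (\<sigma> (\<sigma> (\<sigma> x))) = x"
    and not_order2: "\<exists>x\<in>K. \<sigma> (\<sigma> x) \<noteq> x"
begin

text \<open>An explicit sum rather than \<open>field_trace\<close>: the list of embeddings is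
  obtained from the rationality of these values, and only then are the two traces
  identified.\<close>

definition trace :: "complex \<Rightarrow> complex" where
  "trace x = x + \<sigma> x + \<sigma> (\<sigma> x) + \<sigma> (\<sigma> (\<sigma> x))"

definition anti :: "complex \<Rightarrow> bool" where
  "anti g \<longleftrightarrow> g \<in> K \<and> g \<noteq> 0 \<and> \<sigma> (\<sigma> g) = - g"

lemmas closures = closed subfield_C_add[OF K] subfield_C_mult[OF K] subfield_C_uminus[OF K]
  subfield_C_0[OF K] subfield_C_1[OF K] subfield_C_diff[OF K] subfield_C_rat[OF K] subfield_C_power[OF K]

lemmas hom_simps = hom_on_1[OF hom] hom_on_add[OF hom] hom_on_mult[OF hom] hom_on_uminus[OF K hom]
  hom_on_0[OF K hom] hom_on_diff[OF K hom] hom_on_of_rat[OF K hom] hom_on_power[OF K hom]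

lemma trace_Q_linear: "Q_linear_on K trace"
  by (simp add: Q_linear_on_def trace_def hom_simps closures algebra_simps)

text \<open>If \<sigma> fixed or negated \<open>g\<close>, its square would fix \<open>g\<close>,
  whereas it sends \<open>g\<close> to \<open>- g\<close>. So the orbit of \<open>g\<close> consists
  of four distinct elements, \<open>g\<close>, \<open>\<sigma> g\<close> and their
  negatives.\<close>

lemma anti_facts:
  assumes "anti g"
  shows "\<sigma> (\<sigma> g) = - g" "g \<in> K" "\<sigma> g \<in> K" "g \<noteq> 0" "\<sigma> g \<noteq> 0" "\<sigma> g \<noteq> g" "\<sigma> g \<noteq> - g"
proof -
  show g: "\<sigma> (\<sigma> g) = - g" "g \<in> K" "\<sigma> g \<in> K" "g \<noteq> 0" using assms by (auto simp: anti_def closures)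
  show "\<sigma> g \<noteq> 0" "\<sigma> g \<noteq> g" using g by (auto simp: hom_simps)
  show "\<sigma> g \<noteq> - g"
  proof
    assume "\<sigma> g = - g"
    then have "\<sigma> (\<sigma> g) = g" using g by (simp add: hom_simps)
    then show False using g by simp
  qed
qed

text \<open>Antisymmetrize an element moved by the square of \<sigma>, then clear denominators; the
  integer factor is fixed by \<sigma>.\<close>

lemma integral_anti_exists: "\<exists>g. anti g \<and> g \<in> ring_of_integers K"
proof -
  obtain x where x: "x \<in> K" "\<sigma> (\<sigma> x) \<noteq> x" using not_order2 by blast
  define y where "y = x - \<sigma> (\<sigma> x)"
  have y: "y \<in> K" "y \<noteq> 0" "\<sigma> (\<sigma> y) = - y"
    using x by (auto simp: y_def closures hom_simps order4)
  obtain N :: int where N: "N > 0" "of_int N * y \<in> ring_of_integers K"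
    using integral_multiple_exists[OF K basis y(1)] .
  have "of_int N \<in> K" using subfield_C_rat[OF K, of "of_int N"] by simp
  then have "anti (of_int N * y)"
    using y N(1) by (simp add: anti_def closures hom_simps hom_on_of_int[OF K hom])
  then show ?thesis using N by blast
qed

text \<open>With d = g * \<sigma> g and h = \<sigma> g, the block of 1, d is 16 d^2. That of g, g d
  is 4 d^2 ((g^2 + h^2)^2 - (g^2 - h^2)^2) = 16 d^4, where the sums of squares cancel.\<close>

lemma gram_det_anti:
  assumes "anti g"
  shows "gram_det trace 4 (\<lambda>i. [1, g * \<sigma> g, g, g * (g * \<sigma> g)] ! i) = 256 * (g * \<sigma> g) ^ 6"
proof -
  note g = anti_facts[OF assms]
  have "gram_det trace 4 (\<lambda>i. [1, g * \<sigma> g, g, g * (g * \<sigma> g)] ! i)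
    = (trace (1 * 1) * trace (g * \<sigma> g * (g * \<sigma> g)) - trace (1 * (g * \<sigma> g)) ^ 2)
      * (trace (g * g) * trace (g * (g * \<sigma> g) * (g * (g * \<sigma> g))) - trace (g * (g * (g * \<sigma> g))) ^ 2)"
    by (rule gram_det_block) (simp_all add: trace_def hom_simps closures g algebra_simps)
  also have "trace (1 * 1) = 4" by (simp add: trace_def hom_simps)
  also have "trace (1 * (g * \<sigma> g)) = 0" by (simp add: trace_def hom_simps closures g)
  also have "trace (g * \<sigma> g * (g * \<sigma> g)) = 4 * (g * \<sigma> g)\<^sup>2"
    by (simp add: trace_def hom_simps closures g power2_eq_square)
  also have "trace (g * g) = 2 * (g\<^sup>2 + (\<sigma> g)\<^sup>2)"
    by (simp add: trace_def hom_simps closures g power2_eq_square)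
  also have "trace (g * (g * \<sigma> g) * (g * (g * \<sigma> g))) = 2 * (g\<^sup>2 + (\<sigma> g)\<^sup>2) * (g * \<sigma> g)\<^sup>2"
    by (simp add: trace_def hom_simps closures g power2_eq_square algebra_simps)
  also have "trace (g * (g * (g * \<sigma> g))) = 2 * (g\<^sup>2 - (\<sigma> g)\<^sup>2) * (g * \<sigma> g)"
    by (simp add: trace_def hom_simps closures g power2_eq_square algebra_simps)
  also have "(4 * (4 * (g * \<sigma> g)\<^sup>2) - 0\<^sup>2) * (2 * (g\<^sup>2 + (\<sigma> g)\<^sup>2) * (2 * (g\<^sup>2 + (\<sigma> g)\<^sup>2) * (g * \<sigma> g)\<^sup>2)
      - (2 * (g\<^sup>2 - (\<sigma> g)\<^sup>2) * (g * \<sigma> g))\<^sup>2) = 256 * (g * \<sigma> g) ^ 6"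
    by (simp add: algebra_simps power_numeral_reduce)
  finally show ?thesis .
qed

text \<open>The right-hand side is the product of the squared differences of the four conjugates
  \<open>g\<close>, \<open>- g\<close>, \<open>\<sigma> g\<close>, \<open>- \<sigma> g\<close>. The
  powers are listed with the even ones first to make the blocks visible.\<close>

lemma gram_det_powers:
  assumes "anti g"
  shows "gram_det trace 4 (\<lambda>i. [1, g ^ 2, g, g ^ 3] ! i)
    = 16 * (g * \<sigma> g) ^ 2 * (g ^ 2 - \<sigma> g ^ 2) ^ 4"
proof -
  note g = anti_facts[OF assms]
  have "gram_det trace 4 (\<lambda>i. [1, g ^ 2, g, g ^ 3] ! i)
    = (trace (1 * 1) * trace (g ^ 2 * g ^ 2) - trace (1 * g ^ 2) ^ 2)
      * (trace (g * g) * trace (g ^ 3 * g ^ 3) - trace (g * g ^ 3) ^ 2)"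
    by (rule gram_det_block) (simp_all add: trace_def hom_simps closures g algebra_simps)
  also have "trace (1 * 1) = 4" by (simp add: trace_def hom_simps)
  also have "trace (g ^ 2 * g ^ 2) = 2 * (g ^ 4 + \<sigma> g ^ 4)"
    by (simp add: trace_def hom_simps closures g power_numeral_reduce)
  also have "trace (1 * g ^ 2) = 2 * (g ^ 2 + \<sigma> g ^ 2)"
    by (simp add: trace_def hom_simps closures g power_numeral_reduce)
  also have "trace (g * g) = 2 * (g ^ 2 + \<sigma> g ^ 2)"
    by (simp add: trace_def hom_simps closures g power_numeral_reduce)
  also have "trace (g ^ 3 * g ^ 3) = 2 * (g ^ 6 + \<sigma> g ^ 6)"
    by (simp add: trace_def hom_simps closures g power_numeral_reduce)
  also have "trace (g * g ^ 3) = 2 * (g ^ 4 + \<sigma> g ^ 4)"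
    by (simp add: trace_def hom_simps closures g power_numeral_reduce)
  also have "(4 * (2 * (g ^ 4 + \<sigma> g ^ 4)) - (2 * (g ^ 2 + \<sigma> g ^ 2)) ^ 2)
      * (2 * (g ^ 2 + \<sigma> g ^ 2) * (2 * (g ^ 6 + \<sigma> g ^ 6)) - (2 * (g ^ 4 + \<sigma> g ^ 4)) ^ 2)
    = 16 * (g * \<sigma> g) ^ 2 * (g ^ 2 - \<sigma> g ^ 2) ^ 4"
    by (simp add: algebra_simps power_numeral_reduce)
  finally show ?thesis .
qed

lemma anti_basis_integral:
  assumes "anti g" "g \<in> ring_of_integers K" "i < 4"
  shows "[1, g * \<sigma> g, g, g * (g * \<sigma> g)] ! i \<in> ring_of_integers K"
proof -
  have "\<sigma> g \<in> ring_of_integers K"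
    using assms hom_on_algebraic_integer[OF K hom] closed by (auto simp: ring_of_integers_def)
  moreover have "1 \<in> ring_of_integers K" using ring_of_integers_of_int[OF K, of 1] by simp
  moreover have "i = 0 \<or> i = 1 \<or> i = 2 \<or> i = 3" using assms(3) by linarith
  ultimately show ?thesis using assms(2) ring_of_integers_mult[OF K] by (elim disjE) simp_all
qed

section \<open>Rationality and integrality of the trace\<close>

lemma lessThan_4: "{..<4} = {0, 1, 2, 3 :: nat}"
  by auto

text \<open>In the basis 1, d, g, g d all elements but the first have trace 0, so the trace of
  \<open>x\<close> is 4 times its rational coordinate at 1.\<close>

lemma trace_rat:
  assumes "x \<in> K" shows "\<exists>q. trace x = of_rat q"
proof -
  obtain g where "anti g" using integral_anti_exists by blast
  note g = anti_facts[OF this]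
  let ?v = "\<lambda>i. [1, g * \<sigma> g, g, g * (g * \<sigma> g)] ! i"
  have vK: "?v i \<in> K" if "i < 4" for i
  proof -
    have "i = 0 \<or> i = 1 \<or> i = 2 \<or> i = 3" using that by linarith
    then show ?thesis using g by (elim disjE) (simp_all add: closures)
  qed
  have "gram_det trace 4 ?v \<noteq> 0" using gram_det_anti[OF \<open>anti g\<close>] g by simp
  then have "Q_basis K ?v 4" using Q_basis_if_gram_det_nonzero[OF K trace_Q_linear basis, of ?v] vK by blast
  then obtain c :: "nat \<Rightarrow> rat" where c: "x = (\<Sum>i<4. of_rat (c i) * ?v i)"
    using assms unfolding Q_basis_def by blast
  have "trace x = (\<Sum>i<4. of_rat (c i) * trace (?v i))"
    unfolding c using vK by (intro Q_linear_on_sum[OF K trace_Q_linear]) auto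
  also have "\<dots> = of_rat (4 * c 0)"
    by (simp add: lessThan_4 trace_def hom_simps closures g of_rat_mult algebra_simps)
  finally show ?thesis by blast
qed

lemma trace_Ints:
  assumes "x \<in> ring_of_integers K" shows "trace x \<in> \<int>"
proof -
  have x: "x \<in> K" "algebraic_integer x" using assms by (auto simp: ring_of_integers_def)
  have "algebraic_integer (trace x)"
    unfolding trace_def using x
    by (intro algebraic_integer_add hom_on_algebraic_integer[OF K hom]) (auto intro: closed)
  then show ?thesis using trace_rat[OF x(1)] algebraic_integer_rat by metis
qed

section \<open>Polynomials in \<open>g\<close> and the homomorphisms on \<open>K\<close>\<close>

lemma powers_span:
  assumes "anti g" "x \<in> K"
  obtains c :: "nat \<Rightarrow> rat" where "x = (\<Sum>i<4. of_rat (c i) * [1, g ^ 2, g, g ^ 3] ! i)"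
proof -
  note g = anti_facts[OF assms(1)]
  have vK: "[1, g ^ 2, g, g ^ 3] ! i \<in> K" if "i < 4" for i
  proof -
    have "i = 0 \<or> i = 1 \<or> i = 2 \<or> i = 3" using that by linarith
    then show ?thesis using g by (elim disjE) (simp_all add: closures)
  qed
  \<comment> \<open>This factorization reduces the nonvanishing of the discriminant to \<sigma> g
    being neither \<open>g\<close> nor \<open>- g\<close>.\<close>
  have "g ^ 2 - \<sigma> g ^ 2 = - ((\<sigma> g - g) * (\<sigma> g - (- g)))" by (simp add: algebra_simps power2_eq_square)
  then have "g ^ 2 - \<sigma> g ^ 2 \<noteq> 0" using g(6,7) by (metis eq_iff_diff_eq_0 mult_eq_0_iff neg_equal_0_iff_equal)
  then have "gram_det trace 4 (\<lambda>i. [1, g ^ 2, g, g ^ 3] ! i) \<noteq> 0"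
    using gram_det_powers[OF assms(1)] g by simp
  then have "Q_basis K (\<lambda>i. [1, g ^ 2, g, g ^ 3] ! i) 4"
    using Q_basis_if_gram_det_nonzero[OF K trace_Q_linear basis, of "\<lambda>i. [1, g ^ 2, g, g ^ 3] ! i"] vK
    by blast
  then show ?thesis using that assms(2) unfolding Q_basis_def by blast
qed

text \<open>Every element is a rational polynomial in \<open>g\<close>. For integral
  \<open>g\<close> this shows that the set of Mahler measures defining
  \<open>mahler_measure_OK\<close> is nonempty.\<close>

lemma gen_field_anti:
  assumes "anti g" shows "gen_field g = K"
proof
  show "gen_field g \<subseteq> K" using anti_facts(2)[OF assms] K by (auto simp: gen_field_def)
  show "K \<subseteq> gen_field g"
  proof
    fix x assume "x \<in> K"
    then obtain c :: "nat \<Rightarrow> rat" where c: "x = (\<Sum>i<4. of_rat (c i) * [1, g ^ 2, g, g ^ 3] ! i)"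
      using powers_span[OF assms] by blast
    have "x \<in> F" if F: "subfield_C F" "g \<in> F" for F
      using F unfolding c lessThan_4
      by (simp add: subfield_C_add subfield_C_mult subfield_C_rat subfield_C_power)
    then show "x \<in> gen_field g" by (auto simp: gen_field_def)
  qed
qed

lemma hom_on_eqI:
  assumes g: "anti g" and "hom_on K \<tau>" "hom_on K \<tau>'" "\<tau> g = \<tau>' g" "x \<in> K"
  shows "\<tau> x = \<tau>' x"
proof -
  obtain c :: "nat \<Rightarrow> rat" where c: "x = (\<Sum>i<4. of_rat (c i) * [1, g ^ 2, g, g ^ 3] ! i)"
    using powers_span[OF g assms(5)] .
  have *: "\<rho> x = (\<Sum>i<4. of_rat (c i) * [1, (\<rho> g) ^ 2, \<rho> g, (\<rho> g) ^ 3] ! i)" if \<rho>: "hom_on K \<rho>" for \<rho>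
    unfolding c lessThan_4 using anti_facts(2)[OF g]
    by (simp add: closures hom_on_add[OF \<rho>] hom_on_mult[OF \<rho>] hom_on_of_rat[OF K \<rho>] hom_on_power[OF K \<rho>])
  show ?thesis using *[OF assms(2)] *[OF assms(3)] assms(4) by simp
qed

lemma hom_on_id: "hom_on K (\<lambda>x. x)"
  and hom_on_comp2: "hom_on K (\<lambda>x. \<sigma> (\<sigma> x))"
  and hom_on_comp3: "hom_on K (\<lambda>x. \<sigma> (\<sigma> (\<sigma> x)))"
  by (simp_all add: hom_on_def hom_simps closures)

text \<open>If \<open>\<sigma>\<^sup>2 g = - g\<close>, then \<open>g\<close> is a root of \<open>(X\<^sup>2 - g\<^sup>2) (X\<^sup>2 - (\<sigma> g)\<^sup>2)\<close>, whose coefficients are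
  rational multiples of traces and hence rational; so \<open>\<tau> g\<close> is a root too.\<close>

lemma hom_on_cases:
  assumes \<tau>: "hom_on K \<tau>"
  obtains "\<And>x. x \<in> K \<Longrightarrow> \<tau> x = x" | "\<And>x. x \<in> K \<Longrightarrow> \<tau> x = \<sigma> x"
    | "\<And>x. x \<in> K \<Longrightarrow> \<tau> x = \<sigma> (\<sigma> x)" | "\<And>x. x \<in> K \<Longrightarrow> \<tau> x = \<sigma> (\<sigma> (\<sigma> x))"
proof -
  obtain g where ag: "anti g" using integral_anti_exists by blast
  note g = anti_facts[OF this]
  define u w where "u = g ^ 2" "w = (\<sigma> g) ^ 2"
  obtain p where "trace u = of_rat p" using trace_rat[of u] g by (auto simp: u_w_def closures)
  \<comment> \<open>\<sigma> exchanges \<open>u\<close> and \<open>w\<close>, so the trace counts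
    each twice; for the same reason it fixes \<open>u * w\<close>, whence the factor 4
    below.\<close>
  moreover have "trace u = 2 * (u + w)" by (simp add: trace_def u_w_def hom_simps closures g)
  ultimately have p: "u + w = of_rat (p / 2)" by (simp add: of_rat_divide field_simps)
  obtain q where "trace (u * w) = of_rat q" using trace_rat[of "u * w"] g by (auto simp: u_w_def closures)
  moreover have "trace (u * w) = 4 * (u * w)" by (simp add: trace_def u_w_def hom_simps closures g)
  ultimately have q: "u * w = of_rat (q / 4)" by (simp add: of_rat_divide field_simps)
  have "g ^ 4 - (u + w) * g ^ 2 + u * w = 0" by (simp add: u_w_def algebra_simps power_numeral_reduce)
  then have "\<tau> (g ^ 4 - of_rat (p / 2) * g ^ 2 + of_rat (q / 4)) = 0"
    unfolding p q using hom_on_0[OF K \<tau>] by simp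
  moreover have "\<tau> (g ^ 4 - of_rat (p / 2) * g ^ 2 + of_rat (q / 4))
      = \<tau> g ^ 4 - of_rat (p / 2) * \<tau> g ^ 2 + of_rat (q / 4)"
    using g(2) hom_on_add[OF \<tau>, of "g ^ 4 - of_rat (p / 2) * g ^ 2" "of_rat (q / 4)"]
      hom_on_diff[OF K \<tau>, of "g ^ 4" "of_rat (p / 2) * g ^ 2"]
      hom_on_mult[OF \<tau>, of "of_rat (p / 2)" "g ^ 2"]
    by (simp only: closures hom_on_power[OF K \<tau>] hom_on_of_rat[OF K \<tau>])
  ultimately have "\<tau> g ^ 4 - (u + w) * \<tau> g ^ 2 + u * w = 0" unfolding p q by simp
  then have "(\<tau> g - g) * (\<tau> g + g) * ((\<tau> g - \<sigma> g) * (\<tau> g + \<sigma> g)) = 0"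
    unfolding u_w_def by (simp add: algebra_simps power_numeral_reduce)
  then consider "\<tau> g = g" | "\<tau> g = - g" | "\<tau> g = \<sigma> g" | "\<tau> g = - \<sigma> g"
    by (auto simp: eq_neg_iff_add_eq_0)
  then show ?thesis
  proof cases
    case 1
    show ?thesis by (rule that(1)) (rule hom_on_eqI[OF ag \<tau> hom_on_id 1])
  next
    case 2
    then have "\<tau> g = \<sigma> (\<sigma> g)" using g by simp
    show ?thesis by (rule that(3)) (rule hom_on_eqI[OF ag \<tau> hom_on_comp2 \<open>\<tau> g = \<sigma> (\<sigma> g)\<close>])
  next
    case 3
    show ?thesis by (rule that(2)) (rule hom_on_eqI[OF ag \<tau> hom 3])
  next
    case 4
    then have "\<tau> g = \<sigma> (\<sigma> (\<sigma> g))" using g by (simp add: hom_simps)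
    show ?thesis by (rule that(4)) (rule hom_on_eqI[OF ag \<tau> hom_on_comp3 \<open>\<tau> g = \<sigma> (\<sigma> (\<sigma> g))\<close>])
  qed
qed

text \<open>Every embedding agrees on \<open>K\<close> with one of the four iterates of \<sigma>,
  and these are pairwise different because they take different values at \<open>g\<close>.\<close>

lemma field_trace_eq:
  assumes "x \<in> K" shows "field_trace K x = trace x"
proof -
  obtain g where "anti g" using integral_anti_exists by blast
  note g = anti_facts[OF this]
  \<comment> \<open>Truncation to 0 outside \<open>K\<close>, the convention of
    \<open>embeddings\<close>; it turns a homomorphism on \<open>K\<close> into the one embedding
    that represents it.\<close>
  define r where "r \<tau> = (\<lambda>x. if x \<in> K then \<tau> x else (0 :: complex))" for \<tau> :: "complex \<Rightarrow> complex"
  let ?s2 = "\<lambda>x. \<sigma> (\<sigma> x)" and ?s3 = "\<lambda>x. \<sigma> (\<sigma> (\<sigma> x))"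
  have emb: "\<tau> \<in> embeddings K \<longleftrightarrow> hom_on K \<tau> \<and> \<tau> = r \<tau>" for \<tau>
    by (auto simp: embeddings_def hom_on_def r_def fun_eq_iff)
  have r_hom: "hom_on K (r \<tau>)" if "hom_on K \<tau>" for \<tau>
    using that by (auto simp: hom_on_def r_def closures)
  have rr: "r (r \<tau>) = r \<tau>" for \<tau> by (auto simp: r_def)
  have "embeddings K = {r (\<lambda>x. x), r \<sigma>, r ?s2, r ?s3}"
  proof (intro equalityI subsetI)
    fix \<tau> assume "\<tau> \<in> embeddings K"
    then have \<tau>: "hom_on K \<tau>" "\<tau> = r \<tau>" by (auto simp: emb)
    from \<tau>(1) show "\<tau> \<in> {r (\<lambda>x. x), r \<sigma>, r ?s2, r ?s3}"
    proof (cases rule: hom_on_cases)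
      case 1 then have "r \<tau> = r (\<lambda>x. x)" by (auto simp: r_def) then show ?thesis using \<tau>(2) by simp
    next
      case 2 then have "r \<tau> = r \<sigma>" by (auto simp: r_def) then show ?thesis using \<tau>(2) by simp
    next
      case 3 then have "r \<tau> = r ?s2" by (auto simp: r_def) then show ?thesis using \<tau>(2) by simp
    next
      case 4 then have "r \<tau> = r ?s3" by (auto simp: r_def) then show ?thesis using \<tau>(2) by simp
    qed
  next
    fix \<tau> assume "\<tau> \<in> {r (\<lambda>x. x), r \<sigma>, r ?s2, r ?s3}"
    then show "\<tau> \<in> embeddings K"
      using r_hom hom_on_id hom hom_on_comp2 hom_on_comp3 rr by (auto simp: emb)
  qed
  moreover have "r \<tau> \<noteq> r \<tau>'" if "\<tau> g \<noteq> \<tau>' g" for \<tau> \<tau>'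
    using that g(2) by (auto simp: r_def fun_eq_iff)
  moreover have "g \<noteq> - \<sigma> g" using g(7) by (metis minus_minus)
  then have "g \<noteq> \<sigma> g" "g \<noteq> \<sigma> (\<sigma> g)" "g \<noteq> \<sigma> (\<sigma> (\<sigma> g))" "\<sigma> g \<noteq> \<sigma> (\<sigma> g)"
    "\<sigma> g \<noteq> \<sigma> (\<sigma> (\<sigma> g))" "\<sigma> (\<sigma> g) \<noteq> \<sigma> (\<sigma> (\<sigma> g))"
    using g(1,4-7) \<open>g \<noteq> - \<sigma> g\<close> hom_on_uminus[OF K hom g(2)] by auto
  ultimately have "distinct [r (\<lambda>x. x), r \<sigma>, r ?s2, r ?s3]"
    "embeddings K = set [r (\<lambda>x. x), r \<sigma>, r ?s2, r ?s3]"
    by simp_all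
  then have "field_trace K x = sum_list (map (\<lambda>\<tau>. \<tau> x) [r (\<lambda>x. x), r \<sigma>, r ?s2, r ?s3])"
    unfolding field_trace_def by (simp only: sum_list_distinct_conv_sum_set)
  then show ?thesis using assms by (simp add: trace_def r_def)
qed

end

section \<open>Mahler measure\<close>

text \<open>As \<open>min_poly_Z\<close> is a definite description, existence and uniqueness are
  both due. An annihilating polynomial of least degree, stripped of content and sign, exists. Two
  candidates are proportional by minimality, and equal by content and sign.\<close>

lemma min_poly_Z_root:
  assumes "algebraic_integer \<alpha>"
  shows "min_poly_Z \<alpha> \<noteq> 0" "poly (map_poly of_int (min_poly_Z \<alpha>)) \<alpha> = 0"
proof -
  define Z where "Z p \<longleftrightarrow> p \<noteq> 0 \<and> poly (map_poly of_int p) \<alpha> = 0" for p :: "int poly"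
  define P where "P p \<longleftrightarrow> Z p \<and> content p = 1 \<and> lead_coeff p > 0 \<and> (\<forall>q. Z q \<longrightarrow> degree p \<le> degree q)"
    for p
  obtain p0 :: "int poly" where "lead_coeff p0 = 1" "poly (map_poly of_int p0) \<alpha> = 0"
    using assms unfolding algebraic_integer_def by blast
  then have "Z p0" by (auto simp: Z_def)
  then obtain p where p: "Z p" and min: "\<And>q. Z q \<Longrightarrow> degree p \<le> degree q"
    using ex_has_least_nat[of Z p0 degree] by blast
  define c where "c = sgn (lead_coeff p) * content p"
  define q where "q = smult (sgn (lead_coeff p)) (primitive_part p)"
  have p0: "p \<noteq> 0" using p by (simp add: Z_def)
  have "p = smult c q"
    using p0 by (simp add: c_def q_def sgn_if)
  then have c0: "c \<noteq> 0" "q \<noteq> 0" using p0 by auto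
  have "Z q" using p c0 \<open>p = smult c q\<close> by (auto simp: Z_def of_int_hom.map_poly_hom_smult)
  have cont: "content q = 1" using p0 by (simp add: q_def sgn_if)
  have "degree q = degree p" using c0 \<open>p = smult c q\<close> by simp
  then have "lead_coeff p = c * lead_coeff q" by (metis \<open>p = smult c q\<close> coeff_smult)
  moreover have "content p \<ge> 0" using normalize_content[of p] abs_ge_zero[of "content p"] by simp
  then have "content p > 0" using p0 content_eq_zero_iff[of p] by linarith
  ultimately have "lead_coeff q > 0"
    using p0 by (auto simp: c_def sgn_if zero_less_mult_iff mult_less_0_iff split: if_splits)
  then have Pq: "P q" using \<open>degree q = degree p\<close> \<open>Z q\<close> cont \<open>lead_coeff q > 0\<close> min by (simp add: P_def)
  have uniq: "r = q" if r: "P r" for r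
  proof -
    have deg: "degree r = degree q" using r Pq by (auto simp: P_def intro!: antisym)
    \<comment> \<open>Cross-multiplication cancels the leading terms, so \<open>d\<close>
      annihilates \<alpha> in a degree below the minimum unless it is 0.\<close>
    define d where "d = smult (lead_coeff r) q - smult (lead_coeff q) r"
    have "poly (map_poly of_int d) \<alpha> = 0"
      using r Pq by (simp add: d_def P_def Z_def hom_distribs)
    have "d = 0"
    proof (rule ccontr)
      assume "d \<noteq> 0"
      then have "degree q \<le> degree d" using Pq \<open>poly (map_poly of_int d) \<alpha> = 0\<close> by (auto simp: P_def Z_def)
      moreover have "degree d \<le> degree q"
        unfolding d_def using deg degree_smult_le[of "lead_coeff r" q] degree_smult_le[of "lead_coeff q" r]
        by (intro degree_diff_le) auto
      ultimately have "degree d = degree q" by simp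
      moreover have "coeff d (degree q) = 0" by (simp add: d_def deg)
      ultimately show False using \<open>d \<noteq> 0\<close> by (metis leading_coeff_0_iff)
    qed
    then have eq: "smult (lead_coeff r) q = smult (lead_coeff q) r" by (simp add: d_def)
    then have "content (smult (lead_coeff r) q) = content (smult (lead_coeff q) r)" by simp
    then have "lead_coeff r = lead_coeff q" using r Pq by (simp add: P_def)
    moreover have "lead_coeff r \<noteq> 0" using r by (auto simp: P_def)
    ultimately have "smult (lead_coeff r) (q - r) = 0" using eq by (simp add: smult_diff_right)
    then show ?thesis using \<open>lead_coeff r \<noteq> 0\<close> by simp
  qed
  have "min_poly_Z \<alpha> = (THE p. P p)" by (simp add: min_poly_Z_def P_def Z_def conj_assoc)
  also have "\<dots> = q" using Pq uniq by (rule the_equality)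
  finally show "min_poly_Z \<alpha> \<noteq> 0" "poly (map_poly of_int (min_poly_Z \<alpha>)) \<alpha> = 0"
    using \<open>Z q\<close> by (auto simp: Z_def)
qed

text \<open>It is enough to exhibit some conjugates of \<alpha>, collected in \<open>R\<close>: the
  factors of the other roots are at least 1, multiplicities only enlarge the product, and the
  leading coefficient is a nonzero integer.\<close>

lemma mahler_measure_alg_ge:
  assumes \<alpha>: "algebraic_integer \<alpha>"
    and R: "\<And>x p. x \<in> R \<Longrightarrow> poly (map_poly of_int (p :: int poly)) \<alpha> = 0 \<Longrightarrow> poly (map_poly of_int p) x = 0"
  shows "(\<Prod>x\<in>R. max 1 (cmod x)) \<le> mahler_measure_alg \<alpha>"
proof -
  define f :: "complex poly" where "f = map_poly of_int (min_poly_Z \<alpha>)"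
  have f0: "f \<noteq> 0" using min_poly_Z_root(1)[OF \<alpha>] by (simp add: f_def)
  have fin: "finite {x. poly f x = 0}" using f0 by (rule poly_roots_finite)
  have sub: "R \<subseteq> {x. poly f x = 0}" using R min_poly_Z_root(2)[OF \<alpha>] by (auto simp: f_def)
  have "(\<Prod>x\<in>R. max 1 (cmod x)) \<le> (\<Prod>x\<in>{x. poly f x = 0}. max 1 (cmod x))"
    by (rule prod_mono2[OF fin sub]) auto
  also have "\<dots> \<le> (\<Prod>x\<in>{x. poly f x = 0}. max 1 (cmod x) ^ order x f)"
  proof (rule prod_mono)
    fix x assume "x \<in> {x. poly f x = 0}"
    then have "order x f \<ge> 1" using f0 order_root[of f x] by simp
    then show "0 \<le> max 1 (cmod x) \<and> max 1 (cmod x) \<le> max 1 (cmod x) ^ order x f"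
      using self_le_power[of "max 1 (cmod x)"] by simp
  qed
  also have "\<dots> \<le> cmod (lead_coeff f) * \<dots>"
  proof -
    have "1 \<le> cmod (lead_coeff f)"
      using f0 by (intro cmod_Ints_ge_1) (auto simp: f_def)
    moreover have "0 \<le> (\<Prod>x\<in>{x. poly f x = 0}. max 1 (cmod x) ^ order x f)"
      by (intro prod_nonneg) auto
    ultimately show ?thesis using mult_right_mono by fastforce
  qed
  finally show ?thesis by (simp add: mahler_measure_alg_def mahler_measure_def f_def)
qed

section \<open>Estimates for totally imaginary fields\<close>

context cyclic_quartic_automorphism
begin

text \<open>Conjugation restricts to one of the four iterates of \<sigma>. The identity is excluded
  by the inclusion of \<open>K\<close>, which is not real. The first and third iterates are excluded
  because conjugation is an involution, while both of them square to the second iterate.\<close>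

lemma square_eq_cnj:
  assumes "totally_imaginary K" "x \<in> K"
  shows "\<sigma> (\<sigma> x) = cnj x"
proof -
  have "hom_on K cnj" by (simp add: hom_on_def)
  then show ?thesis
  proof (cases rule: hom_on_cases)
    case 1
    have "(\<lambda>x. if x \<in> K then x else 0) \<in> embeddings K" by (auto simp: embeddings_def closures)
    then obtain y where "y \<in> K" "y \<notin> \<real>" using assms(1) unfolding totally_imaginary_def by force
    then show ?thesis using 1 by (simp add: Reals_cnj_iff)
  next
    case 2
    then have "\<sigma> (\<sigma> y) = y" if "y \<in> K" for y using that closed by (metis complex_cnj_cnj)
    then show ?thesis using not_order2 by blast
  next
    case 3
    then show ?thesis using assms(2) by simp
  next
    case 4
    have "\<sigma> (\<sigma> y) = y" if y: "y \<in> K" for y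
    proof -
      have "y = cnj (cnj y)" by simp
      also have "\<dots> = \<sigma> (\<sigma> (\<sigma> (\<sigma> (\<sigma> (\<sigma> y)))))" using 4 y closed by simp
      also have "\<dots> = \<sigma> (\<sigma> y)" using order4 y closed by simp
      finally show ?thesis by simp
    qed
    then show ?thesis using not_order2 by blast
  qed
qed

text \<open>Otherwise the fixed field of the square of \<sigma> would contain \<alpha> and hence all
  of \<open>K\<close>.\<close>

lemma generator_not_fixed:
  assumes "gen_field \<alpha> = K" "\<alpha> \<in> K"
  shows "\<sigma> (\<sigma> \<alpha>) \<noteq> \<alpha>"
proof
  assume fixed: "\<sigma> (\<sigma> \<alpha>) = \<alpha>"
  define F where "F = {x \<in> K. \<sigma> (\<sigma> x) = x}"
  have "inverse x \<in> F" if x: "x \<in> F" "x \<noteq> 0" for x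
  proof -
    have xK: "x \<in> K" "inverse x \<in> K" using x K by (auto simp: F_def subfield_C_def)
    have "\<sigma> (\<sigma> x) * \<sigma> (\<sigma> (inverse x)) = \<sigma> (\<sigma> (x * inverse x))"
      using xK by (simp only: hom_simps closures)
    then have "x * \<sigma> (\<sigma> (inverse x)) = 1" using x by (simp add: hom_simps F_def)
    then have "\<sigma> (\<sigma> (inverse x)) = inverse x" by (metis inverse_unique)
    then show ?thesis using xK by (simp add: F_def)
  qed
  then have "subfield_C F"
    by (auto simp: subfield_C_def F_def hom_simps closures)
  moreover have "\<alpha> \<in> F" using fixed assms by (simp add: F_def)
  ultimately have "K \<subseteq> F" using assms(1) by (auto simp: gen_field_def)
  then show False using not_order2 by (auto simp: F_def)
qed

text \<open>The family 1, d, g, g d serves twice: it starts the descent to an integral basis, so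
  that \<open>SOME\<close> picks a genuine one, and its discriminant then bounds the discriminant of
  that basis.\<close>

lemma abs_discriminant_le:
  assumes deg: "field_degree K = 4" and g: "anti g" "g \<in> ring_of_integers K"
  shows "abs_discriminant K \<le> 256 * cmod (g * \<sigma> g) ^ 6"
proof -
  let ?v = "\<lambda>i. [1, g * \<sigma> g, g, g * (g * \<sigma> g)] ! i"
  have vI: "\<And>i. i < 4 \<Longrightarrow> ?v i \<in> ring_of_integers K" using anti_basis_integral[OF g] .
  have nz: "gram_det trace 4 ?v \<noteq> 0" using gram_det_anti[OF g(1)] anti_facts[OF g(1)] by simp
  define \<omega> where "\<omega> = (SOME \<omega>. integral_basis K \<omega>)"
  have "\<exists>\<omega>. integral_basis K \<omega>"
    using integral_basis_exists[OF K _ trace_Q_linear trace_Ints, of b ?v] basis vI nz by (simp add: deg)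
  then have \<omega>: "integral_basis K \<omega>" unfolding \<omega>_def by (rule someI_ex)
  have "field_trace K (\<omega> i * \<omega> j) = trace (\<omega> i * \<omega> j)" if "i < 4" "j < 4" for i j
    using \<omega> that by (intro field_trace_eq closures) (auto simp: integral_basis_def ring_of_integers_def deg)
  then have "mat 4 4 (\<lambda>(i, j). field_trace K (\<omega> i * \<omega> j)) = mat 4 4 (\<lambda>(i, j). trace (\<omega> i * \<omega> j))"
    by (intro eq_matI) auto
  then have "abs_discriminant K = cmod (gram_det trace 4 \<omega>)"
    by (simp add: abs_discriminant_def \<omega>_def[symmetric] deg gram_det_def)
  also have "\<dots> \<le> cmod (gram_det trace 4 ?v)"
    using integral_basis_gram_det_le[OF K trace_Q_linear \<omega>, of ?v] vI nz by (simp add: deg)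
  finally show ?thesis by (simp add: gram_det_anti[OF g(1)] norm_mult norm_power)
qed

lemma mahler_measure_generator_ge:
  assumes deg: "field_degree K = 4" and ti: "totally_imaginary K"
    and \<alpha>: "\<alpha> \<in> ring_of_integers K" "gen_field \<alpha> = K"
  shows "abs_discriminant K powr (1/3) / 128 \<le> mahler_measure_alg \<alpha>"
proof -
  define M where "M = mahler_measure_alg \<alpha>"
  define \<beta> where "\<beta> = \<sigma> \<alpha>"
  have aK: "\<alpha> \<in> K" "algebraic_integer \<alpha>" using \<alpha> by (auto simp: ring_of_integers_def)
  have cnj: "\<sigma> (\<sigma> x) = cnj x" if "x \<in> K" for x using square_eq_cnj[OF ti that] .
  have nf: "\<sigma> (\<sigma> \<alpha>) \<noteq> \<alpha>" using generator_not_fixed \<alpha>(2) aK(1) by blast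
  have s3: "\<sigma> (\<sigma> (\<sigma> \<alpha>)) \<noteq> \<alpha>"
  proof
    assume h: "\<sigma> (\<sigma> (\<sigma> \<alpha>)) = \<alpha>"
    then have "\<sigma> \<alpha> = \<alpha>" using order4[OF aK(1)] by simp
    then show False using nf by simp
  qed
  have s1: "\<sigma> \<alpha> \<noteq> \<alpha>" using nf by auto
  have inj: "x = y" if "\<sigma> x = \<sigma> y" "x \<in> K" "y \<in> K" for x y using that order4 by metis
  have dist: "distinct [\<alpha>, \<sigma> \<alpha>, \<sigma> (\<sigma> \<alpha>), \<sigma> (\<sigma> (\<sigma> \<alpha>))]"
    using nf s1 s3 inj[of \<alpha> "\<sigma> \<alpha>"] inj[of \<alpha> "\<sigma> (\<sigma> \<alpha>)"] inj[of "\<sigma> \<alpha>" "\<sigma> (\<sigma> \<alpha>)"] aK(1) closed by auto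
  let ?R = "set [\<alpha>, \<sigma> \<alpha>, \<sigma> (\<sigma> \<alpha>), \<sigma> (\<sigma> (\<sigma> \<alpha>))]"
  have root: "poly (map_poly of_int p) (\<sigma> x) = 0" if "poly (map_poly of_int p) x = 0" "x \<in> K"
    for x and p :: "int poly"
    using hom_on_poly[OF K hom that(2), of p] that(1) hom_on_0[OF K hom] by simp
  have "(\<Prod>x\<in>?R. max 1 (cmod x)) \<le> M"
    unfolding M_def using root aK(1) closed by (intro mahler_measure_alg_ge[OF aK(2)]) auto
  \<comment> \<open>The last two conjugates are the complex conjugates of \<alpha> and \<beta>, so
    every absolute value occurs twice.\<close>
  also have "(\<Prod>x\<in>?R. max 1 (cmod x)) = (max 1 (cmod \<alpha>) * max 1 (cmod \<beta>))\<^sup>2"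
  proof -
    have "(\<Prod>x\<in>?R. max 1 (cmod x)) = prod_list (map (\<lambda>x. max 1 (cmod x)) [\<alpha>, \<sigma> \<alpha>, \<sigma> (\<sigma> \<alpha>), \<sigma> (\<sigma> (\<sigma> \<alpha>))])"
      using dist by (rule prod.distinct_set_conv_list)
    then show ?thesis
      using cnj[OF aK(1)] cnj[OF closed[OF aK(1)]] by (simp add: \<beta>_def power2_eq_square del: set_simps)
  qed
  finally have M: "(max 1 (cmod \<alpha>) * max 1 (cmod \<beta>))\<^sup>2 \<le> M" .
  have "1 * 1 \<le> max 1 (cmod \<alpha>) * max 1 (cmod \<beta>)" by (intro mult_mono) auto
  then have "1 \<le> (max 1 (cmod \<alpha>) * max 1 (cmod \<beta>))\<^sup>2" by (intro one_le_power) simp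
  then have M1: "M \<ge> 1" using M by simp
  have "cmod \<alpha> * cmod \<beta> \<le> max 1 (cmod \<alpha>) * max 1 (cmod \<beta>)" by (intro mult_mono) auto
  then have "(cmod \<alpha> * cmod \<beta>)\<^sup>2 \<le> (max 1 (cmod \<alpha>) * max 1 (cmod \<beta>))\<^sup>2" by (intro power_mono) auto
  then have M2: "(cmod \<alpha> * cmod \<beta>)\<^sup>2 \<le> M" using M by linarith
  define g where "g = \<alpha> - \<sigma> (\<sigma> \<alpha>)"
  have g: "anti g" using nf aK(1) by (auto simp: anti_def g_def closures hom_simps order4)
  have "\<sigma> (\<sigma> \<alpha>) \<in> ring_of_integers K"
    using aK hom_on_algebraic_integer[OF K hom] closed by (auto simp: ring_of_integers_def)
  then have gI: "g \<in> ring_of_integers K" unfolding g_def using \<alpha>(1) by (intro ring_of_integers_diff[OF K])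
  have "cmod g \<le> 2 * cmod \<alpha>"
    unfolding g_def cnj[OF aK(1)] using norm_triangle_ineq4[of \<alpha> "cnj \<alpha>"] by simp
  moreover have "\<sigma> g = \<beta> - cnj \<beta>"
    using aK(1) cnj[of \<beta>] by (simp add: g_def \<beta>_def hom_simps closures)
  then have "cmod (\<sigma> g) \<le> 2 * cmod \<beta>"
    using norm_triangle_ineq4[of \<beta> "cnj \<beta>"] by simp
  ultimately have "cmod (g * \<sigma> g) \<le> (2 * cmod \<alpha>) * (2 * cmod \<beta>)"
    unfolding norm_mult by (intro mult_mono) auto
  then have "cmod (g * \<sigma> g) ^ 6 \<le> ((2 * cmod \<alpha>) * (2 * cmod \<beta>)) ^ 6" by (intro power_mono) auto
  also have "\<dots> = 4096 * ((cmod \<alpha> * cmod \<beta>)\<^sup>2) ^ 3"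
    by (simp add: power_mult_distrib power_mult[symmetric])
  also have "\<dots> \<le> 4096 * M ^ 3" using M2 by (intro mult_left_mono power_mono) auto
  finally have "cmod (g * \<sigma> g) ^ 6 \<le> 4096 * M ^ 3" .
  moreover have "0 \<le> M ^ 3" using M1 by simp
  \<comment> \<open>Here 2097152 = 2^21, whereas 256 * 4096 = 2^20; a factor 2 is to spare.\<close>
  moreover have "(128 * M) ^ 3 = 2097152 * M ^ 3" by (simp add: power_mult_distrib)
  ultimately have "256 * cmod (g * \<sigma> g) ^ 6 \<le> (128 * M) ^ 3" by linarith
  then have "abs_discriminant K \<le> (128 * M) ^ 3" using abs_discriminant_le[OF deg g gI] by linarith
  moreover have "0 \<le> abs_discriminant K" by (simp add: abs_discriminant_def Let_def)
  ultimately have "abs_discriminant K powr (1/3) \<le> ((128 * M) ^ 3) powr (1/3)"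
    by (intro powr_mono2) auto
  also have "\<dots> = 128 * M"
  proof -
    have "(128 * M) ^ 3 = (128 * M) powr real 3" using M1 by (intro powr_realpow[symmetric]) simp
    then have "((128 * M) ^ 3) powr (1/3) = (128 * M) powr (real 3 * (1/3))" by (simp only: powr_powr)
    then show ?thesis using M1 by simp
  qed
  finally show ?thesis by (simp add: M_def)
qed

end

theorem theorem6p1:
  fixes K :: "complex set"
  assumes "cyclic_quartic K" and "totally_imaginary K"
  shows "(1/128) * abs_discriminant K powr (1/3) \<le> mahler_measure_OK K"
proof -
  have nf: "number_field K" and deg: "field_degree K = 4" and gal: "galois_over_Q K"
    using assms(1) by (auto simp: cyclic_quartic_def)
  obtain \<sigma> where \<sigma>: "\<sigma> \<in> embeddings K" "\<forall>x\<in>K. (\<sigma> ^^ 4) x = x" "\<not> (\<forall>x\<in>K. (\<sigma> ^^ 2) x = x)"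
    using assms(1) unfolding cyclic_quartic_def by blast
  have "\<exists>n b. Q_basis K b n" using nf by (auto simp: number_field_def)
  then have "\<exists>b. Q_basis K b (field_degree K)" unfolding field_degree_def by (rule LeastI_ex)
  then obtain b where b: "Q_basis K b 4" using deg by auto
  interpret cyclic_quartic_automorphism K \<sigma> b
  proof
    show "subfield_C K" using nf by (simp add: number_field_def)
    show "Q_basis K b 4" by (rule b)
    show "hom_on K \<sigma>" using \<sigma>(1) by (simp add: embeddings_def hom_on_def)
    show "\<sigma> x \<in> K" if "x \<in> K" for x using gal \<sigma>(1) that by (auto simp: galois_over_Q_def)
    show "\<sigma> (\<sigma> (\<sigma> (\<sigma> x))) = x" if "x \<in> K" for x using \<sigma>(2) that by (simp add: eval_nat_numeral)
    show "\<exists>x\<in>K. \<sigma> (\<sigma> x) \<noteq> x" using \<sigma>(3) by (simp add: eval_nat_numeral)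
  qed
  \<comment> \<open>An integral generator is needed for the infimum to be meaningful: a lower bound
    passes to \<open>Inf\<close> only for a nonempty set.\<close>
  obtain g where "anti g" "g \<in> ring_of_integers K" using integral_anti_exists by blast
  then have "{mahler_measure_alg \<alpha> |\<alpha>. \<alpha> \<in> ring_of_integers K \<and> gen_field \<alpha> = K} \<noteq> {}"
    using gen_field_anti by blast
  then show ?thesis
    unfolding mahler_measure_OK_def
    by (rule cInf_greatest) (use mahler_measure_generator_ge[OF deg assms(2)] in auto)
qed

end
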